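(* Let $\mathcal{P}$ be a monotone property of ordered graphs. Suppose that for every constant $c > 0$ there exists $N = N(c) \in \mathbb{N}$ such that $|\mathcal{P}_N| > c^N$. Then $\mathcal{P}$ contains the ordered graph $H(\pi)$ for every $k \in \mathbb{N}$ and every permutation $\pi$ of $[k]$, and hence $$|\mathcal{P}_n| \ge |\mathcal{P}^{(1,2)}_n| \ge \sum_{k=0}^{\lfloor n/2 \rfloor} \binom{n}{2k} k! = n^{n/2 + o(n)}$$ for every $n \in \mathbb{N}$. This lower bound is best possible, and there is a unique monotone property of ordered graphs with this speed, i.e. there is exactly one monotone property $\mathcal{Q}$ of ordered graphs with $|\mathcal{Q}_n| = \sum_{k=0}^{\lfloor n/2 \rfloor} \binom{n}{2k} k!$ for every $n \in \mathbb{N}$.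
   Context: An ordered graph is a finite (simple, undirected) graph together with a linear order on its vertices. A property of ordered graphs is a collection of ordered graphs closed under order-preserving isomorphisms. It is monotone if it is closed under taking subgraphs (on any subset of the vertices with the induced order, and with any subset of the edges induced there). $\mathcal{P}_n$ is the collection of distinct (non-isomorphic under order-preserving isomorphism) ordered graphs on $n$ vertices in $\mathcal{P}$, and the speed of $\mathcal{P}$ is the function $n \mapsto |\mathcal{P}_n|$. $\mathcal{P}^{(1,2)}$ denotes the set of ordered graphs in $\mathcal{P}$ with maximum degree at most $1$. For a permutation $\pi$ of $[k] = \{1,\ldots,k\}$, $H(\pi)$ is the ordered graph with vertex set $[2k]$ (usual order) and edge set $\{\{i,\pi(i)+k\} : i \in [k]\}$. *)

theory Defs
  imports Complex_Main "HOL-Combinatorics.Permutations" "HOL-Library.Landau_Symbols"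
begin

record 'a ograph =
  verts :: "'a set"
  edges :: "'a set set"
  vord  :: "'a rel"

definition ordered_graph :: "'a ograph \<Rightarrow> bool" where
  "ordered_graph G \<longleftrightarrow>
     finite (verts G) \<and>
     (\<forall>e\<in>edges G. e \<subseteq> verts G \<and> card e = 2) \<and>
     linear_order_on (verts G) (vord G)"

definition ograph_iso :: "'a ograph \<Rightarrow> 'a ograph \<Rightarrow> bool" where
  "ograph_iso G H \<longleftrightarrow>
     (\<exists>f. bij_betw f (verts G) (verts H) \<and>
          (\<forall>x\<in>verts G. \<forall>y\<in>verts G.
             ((x, y) \<in> vord G \<longleftrightarrow> (f x, f y) \<in> vord H) \<and>
             ({x, y} \<in> edges G \<longleftrightarrow> {f x, f y} \<in> edges H)))"

definition iso_rel :: "'a ograph rel" where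
  "iso_rel = {(G, H). ordered_graph G \<and> ordered_graph H \<and> ograph_iso G H}"

text \<open>Not necessarily induced: \<open>H\<close> carries the order induced by \<open>G\<close> on a subset of the
  vertices, and any subset of the edges of \<open>G\<close> inside that subset (the latter restriction
  is part of \<^const>\<open>ordered_graph\<close> for \<open>H\<close>).\<close>

definition subgraph :: "'a ograph \<Rightarrow> 'a ograph \<Rightarrow> bool" where
  "subgraph H G \<longleftrightarrow>
     ordered_graph H \<and> ordered_graph G \<and>
     verts H \<subseteq> verts G \<and> edges H \<subseteq> edges G \<and>
     vord H = vord G \<inter> verts H \<times> verts H"

text \<open>The vertices are natural numbers, with an arbitrary linear order (not necessarily the
  usual one). As \<^typ>\<open>nat\<close> is infinite, every ordered graph is isomorphic to one of these, so
  an isomorphism-closed class of ordered graphs is determined by its members of this type.\<close>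

definition graph_property :: "nat ograph set \<Rightarrow> bool" where
  "graph_property P \<longleftrightarrow>
     (\<forall>G\<in>P. ordered_graph G) \<and>
     (\<forall>G\<in>P. \<forall>H. ordered_graph H \<and> ograph_iso G H \<longrightarrow> H \<in> P)"

definition monotone_property :: "nat ograph set \<Rightarrow> bool" where
  "monotone_property P \<longleftrightarrow>
     graph_property P \<and> (\<forall>G\<in>P. \<forall>H. subgraph H G \<longrightarrow> H \<in> P)"

text \<open>Isomorphism classes; there are finitely many for each \<open>n\<close>, so \<^const>\<open>card\<close> does not degenerate
  in the definition of the speed.\<close>

definition slice :: "nat ograph set \<Rightarrow> nat \<Rightarrow> nat ograph set set" where
  "slice P n = {G \<in> P. card (verts G) = n} // iso_rel"

definition speed :: "nat ograph set \<Rightarrow> nat \<Rightarrow> nat" where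
  "speed P n = card (slice P n)"

definition degree :: "'a ograph \<Rightarrow> 'a \<Rightarrow> nat" where
  "degree G v = card {e \<in> edges G. v \<in> e}"

definition max_degree_le_1 :: "nat ograph set \<Rightarrow> nat ograph set" where
  "max_degree_le_1 P = {G \<in> P. \<forall>v\<in>verts G. degree G v \<le> 1}"

definition perm_graph :: "nat \<Rightarrow> (nat \<Rightarrow> nat) \<Rightarrow> nat ograph" where
  "perm_graph k \<pi> =
     \<lparr>verts = {1..2 * k},
      edges = {{i, \<pi> i + k} | i. i \<in> {1..k}},
      vord = {(x, y). x \<in> {1..2 * k} \<and> y \<in> {1..2 * k} \<and> x \<le> y}\<rparr>"

definition superexponential :: "nat ograph set \<Rightarrow> bool" where
  "superexponential P \<longleftrightarrow> (\<forall>c::real. c > 0 \<longrightarrow> (\<exists>N. real (speed P N) > c ^ N))"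

definition matching_sum :: "nat \<Rightarrow> nat" where
  "matching_sum n = (\<Sum>k = 0..n div 2. (n choose (2 * k)) * fact k)"

end

theory Submission
  imports Defs
begin

text \<open>
  An ordered graph on \<open>n\<close> vertices is coded by the set of points \<open>(i, j)\<close>, \<open>i < j < n\<close>, of its
  adjacency matrix above the diagonal. The pattern to look for is a \<open>k\<close>-grid: \<open>k\<^sup>2\<close> points
  \<open>p i j\<close> of the matrix whose rows increase strictly with \<open>i\<close> and whose columns increase strictly
  with \<open>j\<close>, a permutation pattern that contains every permutation of \<open>[k]\<close>. By the block argument
  of Marcus and Tardos a matrix without a \<open>k\<close>-grid has only linearly many points, and by Klazar's
  contraction argument there are then only exponentially many such matrices. A superexponential
  property therefore contains graphs with arbitrarily large grids, and these contain every matching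
  whose left endpoints all precede its right endpoints. There are \<open>(n choose 2 * k) * fact k\<close>
  of those with \<open>k\<close> edges on \<open>n\<close> vertices. These matchings form a monotone property themselves,
  so a monotone property with the same speed must coincide with it.
\<close>

section \<open>Grids in sets of points\<close>

text \<open>Points with the same index \<open>i\<close> need not lie in one row of the matrix, and
  likewise for columns: only different indices are compared. In this loose form a grid survives the
  replacement of each of its points by any point of the same block.\<close>

definition grid :: "nat \<Rightarrow> (nat \<times> nat) set \<Rightarrow> bool" where
  "grid k A \<longleftrightarrow> (\<exists>r c. (\<forall>i<k. \<forall>j<k. (r i j, c i j) \<in> A) \<and>
     (\<forall>i<k. \<forall>j<k. \<forall>i'<k. \<forall>j'<k.
        (i < i' \<longrightarrow> r i j < r i' j') \<and> (j < j' \<longrightarrow> c i j < c i' j')))"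

lemma grid_converseI:
  assumes "grid k A"
  shows "grid k (A\<inverse>)"
proof -
  from assms obtain r c where "\<forall>i<k. \<forall>j<k. (r i j, c i j) \<in> A"
    "\<forall>i<k. \<forall>j<k. \<forall>i'<k. \<forall>j'<k. (i < i' \<longrightarrow> r i j < r i' j') \<and> (j < j' \<longrightarrow> c i j < c i' j')"
    unfolding grid_def by metis
  then show ?thesis
    unfolding grid_def by (intro exI[of _ "\<lambda>i j. c j i"] exI[of _ "\<lambda>i j. r j i"]) auto
qed

text \<open>The matrix is cut into blocks of side \<open>s\<close>; the contraction records which of
  them are nonempty.\<close>

definition contract :: "nat \<Rightarrow> (nat \<times> nat) set \<Rightarrow> (nat \<times> nat) set" where
  "contract s A = map_prod (\<lambda>x. x div s) (\<lambda>x. x div s) ` A"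

lemma div_less_imp_less: "a div s < b div s \<Longrightarrow> a < (b::nat)"
  by (meson div_le_mono leD leI)

text \<open>Any point of the block represented by a grid point will do, since a strict inequality
  between quotients forces one between the numbers themselves.\<close>

lemma grid_contractD:
  assumes "grid k (contract s A)"
  shows "grid k A"
proof -
  from assms obtain r c where
    mem: "\<And>i j. i < k \<Longrightarrow> j < k \<Longrightarrow> (r i j, c i j) \<in> contract s A" and
    ord: "\<And>i j i' j'. i < k \<Longrightarrow> j < k \<Longrightarrow> i' < k \<Longrightarrow> j' < k \<Longrightarrow>
      (i < i' \<longrightarrow> r i j < r i' j') \<and> (j < j' \<longrightarrow> c i j < c i' j')"
    unfolding grid_def by metis
  have "\<exists>a b. (a, b) \<in> A \<and> a div s = r i j \<and> b div s = c i j" if "i < k" "j < k" for i j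
    using mem[OF that] unfolding contract_def by (auto; metis)
  then obtain r' c' where
    rc: "\<And>i j. i < k \<Longrightarrow> j < k \<Longrightarrow>
      (r' i j, c' i j) \<in> A \<and> r' i j div s = r i j \<and> c' i j div s = c i j"
    by metis
  have "(i < i' \<longrightarrow> r' i j < r' i' j') \<and> (j < j' \<longrightarrow> c' i j < c' i' j')"
    if "i < k" "j < k" "i' < k" "j' < k" for i j i' j'
    using ord[OF that] rc[OF that(1,2)] rc[OF that(3,4)]
      div_less_imp_less[of "r' i j" s "r' i' j'"] div_less_imp_less[of "c' i j" s "c' i' j'"]
    by simp
  then show ?thesis
    unfolding grid_def using rc by (intro exI[of _ r'] exI[of _ c']) simp
qed

lemma contract_subset:
  assumes "A \<subseteq> {..<s * m} \<times> {..<s * m}"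
  shows "contract s A \<subseteq> {..<m} \<times> {..<m}"
  using assms unfolding contract_def
  by (auto simp: less_mult_imp_div_less mult.commute)

text \<open>The columns are absolute, not relative to the block, so blocks above each other can be
  compared. Nonempty rows are obtained as columns of the converse with the block indices
  exchanged.\<close>

definition block_cols :: "nat \<Rightarrow> (nat \<times> nat) set \<Rightarrow> nat \<Rightarrow> nat \<Rightarrow> nat set" where
  "block_cols s A a b = {y. y div s = b \<and> (\<exists>x. x div s = a \<and> (x, y) \<in> A)}"

lemma div_eq_iff_interval:
  assumes "s > (0::nat)"
  shows "y div s = b \<longleftrightarrow> y \<in> {b * s..<b * s + s}"
  using assms by (auto simp: div_nat_eqI dividend_less_times_div mult.commute add.commute)

lemma ex_strict_mono_enum:
  fixes S :: "nat set"
  assumes "finite S" "k \<le> card S"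
  shows "\<exists>e. (\<forall>i<k. e i \<in> S) \<and> (\<forall>i<k. \<forall>j<k. i < j \<longrightarrow> e i < (e j :: nat))"
proof -
  let ?e = "\<lambda>i. sorted_list_of_set S ! i"
  have "?e i \<in> S" if "i < k" for i
    using assms that by (metis length_sorted_list_of_set nth_mem order_less_le_trans
        set_sorted_list_of_set)
  moreover have "?e i < ?e j" if "i < j" "j < k" for i j
    using assms that strict_sorted_list_of_set[of S]
    by (simp add: sorted_wrt_iff_nth_less)
  ultimately show ?thesis by (intro exI[of _ ?e]) auto
qed

text \<open>Blocks of one block column that share \<open>k\<close> nonempty columns form a grid as soon as there are
  \<open>k\<close> of them; the factor \<open>s choose k\<close> is the pigeonhole over the possible shared columns.\<close>

lemma card_wide_blocks_le:
  assumes "\<not> grid k A" "s > 0"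
  shows "card {a. a < m \<and> k \<le> card (block_cols s A a b)} \<le> k * (s choose k)"
proof -
  let ?B = "{a. a < m \<and> k \<le> card (block_cols s A a b)}"
  let ?I = "{b * s..<b * s + s}"
  let ?\<W> = "{W. W \<subseteq> ?I \<and> card W = k}"
  \<comment> \<open>\<open>?F W\<close> collects the block rows whose block in block column
    \<open>b\<close> has a point in every column of \<open>W\<close>.\<close>
  let ?F = "\<lambda>W. {a. a < m \<and> W \<subseteq> block_cols s A a b}"
  have small: "card (?F W) \<le> k" if W: "W \<in> ?\<W>" for W
  proof (rule ccontr)
    assume "\<not> card (?F W) \<le> k"
    then obtain e where e: "\<forall>i<k. e i \<in> ?F W" "\<forall>i<k. \<forall>j<k. i < j \<longrightarrow> e i < e j"
      using ex_strict_mono_enum[of "?F W" k] by auto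
    have "finite W" using W finite_subset by blast
    then obtain c where c: "\<forall>j<k. c j \<in> W" "\<forall>i<k. \<forall>j<k. i < j \<longrightarrow> c i < c j"
      using W ex_strict_mono_enum[of W k] by auto
    have "\<exists>x. x div s = e i \<and> (x, c j) \<in> A" if "i < k" "j < k" for i j
      using e(1) c(1) that unfolding block_cols_def by blast
    \<comment> \<open>The grid takes its rows from \<open>k\<close> different block rows and its
      columns from \<open>W\<close>, the same ones in every block.\<close>
    then obtain r where r: "\<And>i j. i < k \<Longrightarrow> j < k \<Longrightarrow> r i j div s = e i \<and> (r i j, c j) \<in> A"
      by metis
    have "r i j < r i' j'" if "i < k" "j < k" "i' < k" "j' < k" "i < i'" for i j i' j'
      using r[of i j] r[of i' j'] that e(2) div_less_imp_less by metis
    then have "grid k A"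
      unfolding grid_def using r c(2)
      by (intro exI[of _ r] exI[of _ "\<lambda>i j. c j"]) simp
    with assms(1) show False by simp
  qed
  have "?B \<subseteq> (\<Union>W\<in>?\<W>. ?F W)"
  proof
    fix a assume a: "a \<in> ?B"
    then obtain W where W: "W \<subseteq> block_cols s A a b" "card W = k"
      using obtain_subset_with_card_n by (metis (no_types, lifting) mem_Collect_eq)
    have "block_cols s A a b \<subseteq> ?I"
      using div_eq_iff_interval[OF assms(2)] unfolding block_cols_def by blast
    with W a show "a \<in> (\<Union>W\<in>?\<W>. ?F W)" by blast
  qed
  moreover have fin: "finite ?\<W>" by simp
  ultimately have "card ?B \<le> card (\<Union>W\<in>?\<W>. ?F W)"
    by (intro card_mono) auto
  also have "\<dots> \<le> (\<Sum>W\<in>?\<W>. card (?F W))"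
    by (rule card_UN_le[OF fin])
  also have "\<dots> \<le> (\<Sum>W\<in>?\<W>. k)"
    by (rule sum_mono[OF small])
  also have "\<dots> = k * (s choose k)"
    by (simp add: n_subsets)
  finally show ?thesis .
qed

section \<open>The linear bound for sets without a grid\<close>

lemma block_cols_converse:
  "block_cols s (A\<inverse>) b a = {x. x div s = a \<and> (\<exists>y. y div s = b \<and> (x, y) \<in> A)}"
  unfolding block_cols_def by auto

lemma card_Sigma_le:
  assumes "\<And>b. b < m \<Longrightarrow> card {a. a < m \<and> P a b} \<le> (d::nat)"
  shows "card {(a, b). a < m \<and> b < m \<and> P a b} \<le> m * d"
proof -
  have "{(a, b). a < m \<and> b < m \<and> P a b} = (\<lambda>(b, a). (a, b)) ` (SIGMA b:{..<m}. {a. a < m \<and> P a b})"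
    by auto
  also have "card \<dots> = card (SIGMA b:{..<m}. {a. a < m \<and> P a b})"
    by (intro card_image) (auto simp: inj_on_def)
  also have "\<dots> = (\<Sum>b<m. card {a. a < m \<and> P a b})" by simp
  also have "\<dots> \<le> (\<Sum>b<m. d)" by (rule sum_mono) (use assms in auto)
  finally show ?thesis by simp
qed

text \<open>The first summand of the bound in \<open>card_le_contract\<close> for
  \<open>s = k * k\<close> and \<open>m = 1\<close>.\<close>

definition mt_const :: "nat \<Rightarrow> nat" where
  "mt_const k = 2 * k * ((k * k) choose k) * (k * k) * (k * k)"

text \<open>A block with at least \<open>k\<close> nonempty columns or at least \<open>k\<close>
  nonempty rows may hold up to \<open>s * s\<close> points, but \<open>card_wide_blocks_le\<close>,
  applied to \<open>A\<close> and to its converse, leaves few of these. Every other nonempty block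
  lies in a product of at most \<open>k - 1\<close> rows and \<open>k - 1\<close> columns.\<close>

lemma card_le_contract:
  assumes A: "A \<subseteq> {..<s * m} \<times> {..<s * m}" and ng: "\<not> grid k A" and k: "k > 0" and s: "s > 0"
  shows "card A \<le> 2 * m * (k * (s choose k)) * (s * s) + (k - 1) * (k - 1) * card (contract s A)"
proof -
  let ?B = "contract s A"
  let ?blk = "\<lambda>(a, b). {(x, y) \<in> A. x div s = a \<and> y div s = b}"
  let ?W = "{(a, b). a < m \<and> b < m \<and> k \<le> card (block_cols s A a b)}"
  let ?T = "{(a, b). a < m \<and> b < m \<and> k \<le> card (block_cols s (A\<inverse>) b a)}"
  have finA: "finite A" using A finite_subset by blast
  have finB: "finite ?B" using finA unfolding contract_def by simp
  have finW: "finite ?W" and finT: "finite ?T"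
    by (auto intro: finite_subset[of _ "{..<m} \<times> {..<m}"])
  have W: "card ?W \<le> m * (k * (s choose k))"
    by (rule card_Sigma_le) (rule card_wide_blocks_le[OF ng s])
  have ngc: "\<not> grid k (A\<inverse>)" using ng grid_converseI by fastforce
  have "card {(b, a). b < m \<and> a < m \<and> k \<le> card (block_cols s (A\<inverse>) b a)} \<le> m * (k * (s choose k))"
    by (rule card_Sigma_le) (rule card_wide_blocks_le[OF ngc s])
  moreover have "{(b, a). b < m \<and> a < m \<and> k \<le> card (block_cols s (A\<inverse>) b a)} = ?T\<inverse>" by auto
  ultimately have T: "card ?T \<le> m * (k * (s choose k))" by (simp only: card_inverse)
  have blk_sub: "?blk (a, b) \<subseteq> block_cols s (A\<inverse>) b a \<times> block_cols s A a b" for a b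
    unfolding block_cols_converse unfolding block_cols_def by auto
  have fin_cols: "finite (block_cols s A' a b)" "card (block_cols s A' a b) \<le> s" for A' a b
  proof -
    have sub: "block_cols s A' a b \<subseteq> {b * s..<b * s + s}"
      using div_eq_iff_interval[OF s] unfolding block_cols_def by blast
    then show "finite (block_cols s A' a b)" using finite_subset by blast
    show "card (block_cols s A' a b) \<le> s" using card_mono[OF _ sub] by simp
  qed
  have blk_le: "card (?blk (a, b)) \<le> card (block_cols s (A\<inverse>) b a) * card (block_cols s A a b)" for a b
    unfolding card_cartesian_product[symmetric]
    by (rule card_mono[OF _ blk_sub]) (use fin_cols in auto)
  have blk_big: "card (?blk p) \<le> s * s" for p
    using blk_le mult_le_mono[OF fin_cols(2) fin_cols(2)] le_trans by (cases p) blast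
  have blk_small: "card (?blk p) \<le> (k - 1) * (k - 1)" if "p \<in> ?B - (?W \<union> ?T)" for p
  proof -
    obtain a b where p: "p = (a, b)" by force
    have "a < m" "b < m" using that contract_subset[OF A] p by auto
    then have "card (block_cols s (A\<inverse>) b a) \<le> k - 1" "card (block_cols s A a b) \<le> k - 1"
      using that p by auto
    then show ?thesis unfolding p using blk_le mult_le_mono le_trans by blast
  qed
  have "card A \<le> card (\<Union>p\<in>?B. ?blk p)"
    by (rule card_mono) (use finA finB in \<open>auto simp: contract_def intro: finite_subset\<close>)
  also have "\<dots> \<le> (\<Sum>p\<in>?B. card (?blk p))" by (rule card_UN_le[OF finB])
  also have "\<dots> \<le> (\<Sum>p\<in>(?W \<union> ?T) \<union> (?B - (?W \<union> ?T)). card (?blk p))"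
    by (rule sum_mono2) (use finB finW finT in auto)
  also have "\<dots> = (\<Sum>p\<in>?W \<union> ?T. card (?blk p)) + (\<Sum>p\<in>?B - (?W \<union> ?T). card (?blk p))"
    by (rule sum.union_disjoint) (use finB finW finT in auto)
  also have "\<dots> \<le> card (?W \<union> ?T) * (s * s) + card (?B - (?W \<union> ?T)) * ((k - 1) * (k - 1))"
    by (intro add_mono sum_bounded_above[where 'a=nat, simplified] blk_big blk_small)
  also have "\<dots> \<le> (m * (k * (s choose k)) + m * (k * (s choose k))) * (s * s) + card ?B * ((k - 1) * (k - 1))"
    by (intro add_mono mult_right_mono order.trans[OF card_Un_le] W T card_mono finB) auto
  also have "\<dots> = 2 * m * (k * (s choose k)) * (s * s) + (k - 1) * (k - 1) * card ?B"
    by (simp add: algebra_simps)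
  finally show ?thesis .
qed

text \<open>Induction over contractions with blocks of side \<open>k * k\<close>. This side turns
  the estimate of \<open>card_le_contract\<close> into the old bound multiplied by
  \<open>1 + (k - 1) * (k - 1)\<close>, which is at most \<open>k * k\<close>, the factor by which
  the side of the matrix grows.\<close>

lemma card_le_of_not_grid:
  assumes "k \<ge> 2" "\<not> grid k A" "A \<subseteq> {..<(k * k) ^ j} \<times> {..<(k * k) ^ j}"
  shows "card A \<le> mt_const k * (k * k) ^ j"
  using assms(2,3)
proof (induction j arbitrary: A)
  case 0
  have "card A \<le> card ({..<1::nat} \<times> {..<1::nat})"
    by (rule card_mono) (use 0 in auto)
  moreover have "mt_const k > 0"
    using assms(1) unfolding mt_const_def by (simp add: zero_less_binomial_iff)
  ultimately show ?case by simp
next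
  case (Suc j)
  let ?s = "k * k" let ?m = "?s ^ j" let ?D = "mt_const k"
  have A: "A \<subseteq> {..<?s * ?m} \<times> {..<?s * ?m}" using Suc.prems(2) by simp
  have "card (contract ?s A) \<le> ?D * ?m"
    using Suc.IH contract_subset[OF A] Suc.prems(1) grid_contractD by blast
  then have "(k - 1) * (k - 1) * card (contract ?s A) \<le> (k - 1) * (k - 1) * (?D * ?m)"
    by (rule mult_left_mono) simp
  moreover have "card A \<le> ?D * ?m + (k - 1) * (k - 1) * card (contract ?s A)"
    using card_le_contract[OF A Suc.prems(1)] assms(1) unfolding mt_const_def
    by (simp add: algebra_simps)
  ultimately have "card A \<le> (1 + (k - 1) * (k - 1)) * (?D * ?m)"
    by (simp only: distrib_right mult_1)
  also have "\<dots> \<le> ?s * (?D * ?m)"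
  proof (rule mult_right_mono)
    obtain l where "k = Suc l" using assms(1) by (cases k) auto
    then show "1 + (k - 1) * (k - 1) \<le> k * k" by simp
  qed simp
  finally show ?case by (simp add: algebra_simps)
qed

section \<open>Counting the sets without a grid\<close>

definition gridless :: "nat \<Rightarrow> nat \<Rightarrow> (nat \<times> nat) set set" where
  "gridless k n = {A. A \<subseteq> {..<n} \<times> {..<n} \<and> \<not> grid k A}"

lemma finite_gridless: "finite (gridless k n)"
  unfolding gridless_def by (rule finite_subset[of _ "Pow ({..<n} \<times> {..<n})"]) auto

text \<open>The contraction of a gridless set is gridless, so it has at most \<open>d\<close>
  points. The set lies inside the blocks named by these points, which have at most
  \<open>s * s * d\<close> cells in total; this bounds the number of sets with a given
  contraction.\<close>

lemma card_gridless_step: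
  assumes "s > 0" "\<And>B. B \<in> gridless k m \<Longrightarrow> card B \<le> d"
  shows "card (gridless k (s * m)) \<le> card (gridless k m) * 2 ^ (s * s * d)"
proof -
  let ?pre = "\<lambda>B. \<Union>(a, b)\<in>B. {a * s..<a * s + s} \<times> {b * s..<b * s + s}"
  have sub: "gridless k (s * m) \<subseteq> (\<Union>B\<in>gridless k m. Pow (?pre B))"
  proof
    fix A assume A: "A \<in> gridless k (s * m)"
    then have "contract s A \<in> gridless k m"
      unfolding gridless_def using contract_subset grid_contractD by blast
    moreover have "A \<subseteq> ?pre (contract s A)"
    proof
      fix p assume "p \<in> A"
      moreover obtain x y where "p = (x, y)" by force
      ultimately show "p \<in> ?pre (contract s A)"
        unfolding contract_def using div_eq_iff_interval[OF assms(1)]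
        by (intro UN_I[of "(x div s, y div s)"]) force+
    qed
    ultimately show "A \<in> (\<Union>B\<in>gridless k m. Pow (?pre B))" by blast
  qed
  have finB: "finite B" if "B \<in> gridless k m" for B
    using that finite_subset unfolding gridless_def by blast
  have fin: "finite (?pre B)" if "B \<in> gridless k m" for B
    using finB[OF that] by auto
  have "card (Pow (?pre B)) \<le> 2 ^ (s * s * d)" if B: "B \<in> gridless k m" for B
  proof -
    have "card (?pre B) \<le> (\<Sum>p\<in>B. card ((\<lambda>(a, b). {a * s..<a * s + s} \<times> {b * s..<b * s + s}) p))"
      by (rule card_UN_le[OF finB[OF B]])
    also have "\<dots> = (\<Sum>p\<in>B. s * s)" by (rule sum.cong) auto
    also have "\<dots> \<le> s * s * d" using assms(2)[OF B] by simp
    finally show ?thesis using fin[OF B] by (simp add: card_Pow)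
  qed
  then have "(\<Sum>B\<in>gridless k m. card (Pow (?pre B))) \<le> card (gridless k m) * 2 ^ (s * s * d)"
    by (rule sum_bounded_above[where 'a=nat, simplified])
  moreover have "card (gridless k (s * m)) \<le> card (\<Union>B\<in>gridless k m. Pow (?pre B))"
    by (rule card_mono[OF _ sub]) (use fin finite_gridless in auto)
  ultimately show ?thesis
    using card_UN_le[OF finite_gridless, of "\<lambda>B. Pow (?pre B)" k m] by linarith
qed

text \<open>By the linear bound, passing from side \<open>m\<close> to side \<open>k * k * m\<close>
  adds at most a fixed multiple of \<open>m\<close> to the exponent. That at most doubles the
  exponent of the induction hypothesis, while the claim lets it grow by the factor
  \<open>k * k\<close>, which is at least 2.\<close>

lemma card_gridless_power_le:
  assumes "k \<ge> 2"
  shows "card (gridless k ((k * k) ^ j)) \<le> 2 ^ (k * k * (k * k) * mt_const k * (k * k) ^ j)"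
proof (induction j)
  case 0
  have "gridless k 1 \<subseteq> Pow {(0, 0)}" unfolding gridless_def by auto
  then have "card (gridless k 1) \<le> card (Pow {(0::nat, 0::nat)})" by (intro card_mono) auto
  also have "\<dots> = 2 ^ 1" by (simp add: card_Pow)
  also have "(2::nat) ^ 1 \<le> 2 ^ (k * k * (k * k) * mt_const k)"
    using assms unfolding mt_const_def
    by (intro power_increasing) (auto simp: Suc_le_eq zero_less_binomial_iff)
  finally show ?case by simp
next
  case (Suc j)
  let ?s = "k * k" let ?X = "?s * ?s * mt_const k" let ?m = "?s ^ j"
  have s2: "2 \<le> ?s" using assms by (metis le_trans le_square)
  have "card (gridless k (?s * ?m)) \<le> card (gridless k ?m) * 2 ^ (?s * ?s * (mt_const k * ?m))"
    by (rule card_gridless_step)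
       (use assms card_le_of_not_grid in \<open>auto simp: gridless_def\<close>)
  also have "\<dots> \<le> 2 ^ (?X * ?m) * 2 ^ (?X * ?m)"
    using Suc by (simp add: algebra_simps)
  also have "\<dots> = 2 ^ (2 * (?X * ?m))" by (simp add: power_add[symmetric] mult_2)
  also have "\<dots> \<le> 2 ^ (?s * (?X * ?m))"
    by (intro power_increasing mult_right_mono s2) auto
  finally show ?case by (simp add: algebra_simps)
qed

lemma gridless_exponential:
  assumes "k \<ge> 2"
  shows "\<exists>c::nat. c > 0 \<and> (\<forall>n. card (gridless k n) \<le> c ^ n)"
proof -
  let ?s = "k * k" let ?X = "?s * ?s * mt_const k"
  have s2: "2 \<le> ?s" using assms by (metis le_trans le_square)
  have "card (gridless k n) \<le> (2 ^ (?X * ?s)) ^ n" for n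
  proof (cases "n = 0")
    case True
    have "gridless k 0 \<subseteq> {{}}" unfolding gridless_def by auto
    then have "card (gridless k 0) \<le> card {{} :: (nat \<times> nat) set}" by (intro card_mono) auto
    with True show ?thesis by simp
  next
    case False
    \<comment> \<open>Rounding \<open>n\<close> up to a power of \<open>k * k\<close> costs at most
      a factor \<open>k * k\<close>, which is absorbed into the base of the exponential.\<close>
    then obtain j where j: "?s ^ j \<le> n" "n < ?s ^ (j + 1)"
      using ex_power_ivl1[OF s2, of n] by auto
    have "gridless k n \<subseteq> gridless k (?s ^ (j + 1))"
    proof -
      have "{..<n} \<times> {..<n} \<subseteq> {..<?s ^ (j + 1)} \<times> {..<?s ^ (j + 1)}" using j(2) by auto
      then show ?thesis unfolding gridless_def by blast
    qed
    then have "card (gridless k n) \<le> card (gridless k (?s ^ (j + 1)))"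
      by (rule card_mono[OF finite_gridless])
    also have "\<dots> \<le> 2 ^ (?X * ?s ^ (j + 1))" by (rule card_gridless_power_le[OF assms])
    also have "\<dots> \<le> 2 ^ (?X * ?s * n)"
      using j(1) by (intro power_increasing) (auto simp: mult.assoc)
    finally show ?thesis by (simp add: power_mult)
  qed
  then show ?thesis by (intro exI[of _ "2 ^ (?X * ?s)"]) auto
qed

section \<open>Coding ordered graphs\<close>

definition pairs :: "nat \<Rightarrow> (nat \<times> nat) set" where
  "pairs n = {(i, j). i < j \<and> j < n}"

text \<open>The canonical form: an ordered graph on \<open>n\<close> vertices is isomorphic to
  \<open>std_graph n E\<close> for exactly one \<open>E \<subseteq> pairs n\<close>, so counting
  isomorphism classes becomes counting sets of pairs.\<close>

definition std_graph :: "nat \<Rightarrow> (nat \<times> nat) set \<Rightarrow> nat ograph" where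
  "std_graph n E =
     \<lparr>verts = {..<n}, edges = (\<lambda>(i, j). {i, j}) ` E, vord = {(x, y). x \<le> y \<and> y < n}\<rparr>"

definition codes :: "nat ograph set \<Rightarrow> nat \<Rightarrow> (nat \<times> nat) set set" where
  "codes P n = {E. E \<subseteq> pairs n \<and> std_graph n E \<in> P}"

lemma finite_pairs: "finite (pairs n)"
  unfolding pairs_def by (rule finite_subset[of _ "{..<n} \<times> {..<n}"]) auto

lemma finite_codes: "finite (codes P n)"
  unfolding codes_def by (rule finite_subset[of _ "Pow (pairs n)"]) (auto simp: finite_pairs)

lemmas linear_order_unfold =
  linear_order_on_def partial_order_on_def preorder_on_def refl_on_def trans_def antisym_def
  total_on_def

lemma ordered_std_graph:
  assumes "E \<subseteq> pairs n"
  shows "ordered_graph (std_graph n E)"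
  using assms unfolding ordered_graph_def std_graph_def pairs_def linear_order_unfold
  by (fastforce simp: card_insert_if)

lemma edge_std_graph:
  "{x, y} \<in> edges (std_graph n E) \<longleftrightarrow> (x, y) \<in> E \<or> (y, x) \<in> E"
  unfolding std_graph_def by (auto simp: doubleton_eq_iff image_iff)

lemma verts_std_graph [simp]: "verts (std_graph n E) = {..<n}"
  by (simp add: std_graph_def)

lemma vord_std_graph: "(x, y) \<in> vord (std_graph n E) \<longleftrightarrow> x \<le> y \<and> y < n"
  by (simp add: std_graph_def)

section \<open>Isomorphism classes and their canonical representatives\<close>

lemma ograph_iso_refl: "ograph_iso G G"
  unfolding ograph_iso_def by (intro exI[of _ id]) simp

lemma ograph_iso_sym:
  assumes "ograph_iso G H"
  shows "ograph_iso H G"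
proof -
  obtain f where f: "bij_betw f (verts G) (verts H)" and
    iso: "\<And>x y. x \<in> verts G \<Longrightarrow> y \<in> verts G \<Longrightarrow>
      ((x, y) \<in> vord G \<longleftrightarrow> (f x, f y) \<in> vord H) \<and> ({x, y} \<in> edges G \<longleftrightarrow> {f x, f y} \<in> edges H)"
    using assms unfolding ograph_iso_def by blast
  let ?g = "the_inv_into (verts G) f"
  have g: "bij_betw ?g (verts H) (verts G)" by (rule bij_betw_the_inv_into[OF f])
  have "?g x \<in> verts G" "f (?g x) = x" if "x \<in> verts H" for x
    using that f g by (auto simp: bij_betw_def f_the_inv_into_f)
  then show ?thesis
    unfolding ograph_iso_def using g iso by (intro exI[of _ ?g]) simp
qed

lemma ograph_iso_trans:
  assumes "ograph_iso G H" "ograph_iso H K"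
  shows "ograph_iso G K"
proof -
  obtain f where f: "bij_betw f (verts G) (verts H)" and
    isof: "\<And>x y. x \<in> verts G \<Longrightarrow> y \<in> verts G \<Longrightarrow>
      ((x, y) \<in> vord G \<longleftrightarrow> (f x, f y) \<in> vord H) \<and> ({x, y} \<in> edges G \<longleftrightarrow> {f x, f y} \<in> edges H)"
    using assms(1) unfolding ograph_iso_def by blast
  obtain g where g: "bij_betw g (verts H) (verts K)" and
    isog: "\<And>x y. x \<in> verts H \<Longrightarrow> y \<in> verts H \<Longrightarrow>
      ((x, y) \<in> vord H \<longleftrightarrow> (g x, g y) \<in> vord K) \<and> ({x, y} \<in> edges H \<longleftrightarrow> {g x, g y} \<in> edges K)"
    using assms(2) unfolding ograph_iso_def by blast
  have "f x \<in> verts H" if "x \<in> verts G" for x using that f by (auto simp: bij_betw_def)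
  then show ?thesis
    unfolding ograph_iso_def using bij_betw_trans[OF f g] isof isog
    by (intro exI[of _ "g \<circ> f"]) simp
qed

lemma equiv_iso_rel: "equiv {G. ordered_graph G} iso_rel"
  unfolding equiv_def refl_on_def sym_def trans_def iso_rel_def
  using ograph_iso_refl ograph_iso_sym ograph_iso_trans by blast

lemma ordered_graph_edgeD:
  assumes "ordered_graph G" "{x, y} \<in> edges G"
  shows "x \<in> verts G" "y \<in> verts G" "x \<noteq> y"
  using assms unfolding ordered_graph_def by fastforce+

lemma ordered_graph_vord:
  assumes "ordered_graph G"
  shows "finite (verts G)" "vord G \<subseteq> verts G \<times> verts G" "refl_on (verts G) (vord G)"
    "trans (vord G)" "antisym (vord G)" "total_on (verts G) (vord G)"
  using assms unfolding ordered_graph_def linear_order_on_def partial_order_on_def preorder_on_def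
  by auto

text \<open>A vertex is sent to the number of its predecessors.\<close>

lemma ex_std_graph:
  assumes "ordered_graph G"
  shows "\<exists>E \<subseteq> pairs (card (verts G)). ograph_iso G (std_graph (card (verts G)) E)"
proof -
  let ?V = "verts G" let ?n = "card ?V"
  note G = ordered_graph_vord[OF assms]
  define f where "f x = card {y \<in> ?V. (y, x) \<in> vord G \<and> y \<noteq> x}" for x
  define E where "E = {(f x, f y) | x y. {x, y} \<in> edges G \<and> (x, y) \<in> vord G}"
  have less: "f x < f y" if "(x, y) \<in> vord G" "x \<noteq> y" for x y
    unfolding f_def
  proof (rule psubset_card_mono)
    show "finite {z \<in> ?V. (z, y) \<in> vord G \<and> z \<noteq> y}" using G(1) by simp
    have "x \<in> {z \<in> ?V. (z, y) \<in> vord G \<and> z \<noteq> y}" using that G(2) by auto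
    moreover have "z \<noteq> y" if "(z, x) \<in> vord G" for z
      using that \<open>(x, y) \<in> vord G\<close> \<open>x \<noteq> y\<close> G(5) unfolding antisym_def by blast
    ultimately show "{z \<in> ?V. (z, x) \<in> vord G \<and> z \<noteq> x} \<subset> {z \<in> ?V. (z, y) \<in> vord G \<and> z \<noteq> y}"
      using that G(4) unfolding trans_def by blast
  qed
  have tot: "(x, y) \<in> vord G \<or> (y, x) \<in> vord G" if "x \<in> ?V" "y \<in> ?V" for x y
    using that G(3,6) unfolding refl_on_def total_on_def by metis
  have ord: "(x, y) \<in> vord G \<longleftrightarrow> f x \<le> f y" if "x \<in> ?V" "y \<in> ?V" for x y
    using tot[OF that] less[of x y] less[of y x] by fastforce
  have inj: "inj_on f ?V"
    by (rule inj_onI) (use ord G(5) in \<open>auto simp: antisym_def\<close>)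
  have lt: "f x < ?n" if "x \<in> ?V" for x
    unfolding f_def by (rule psubset_card_mono) (use that G(1) in auto)
  have bij: "bij_betw f ?V {..<?n}"
    unfolding bij_betw_def
    using inj lt card_subset_eq[of "{..<?n}" "f ` ?V"] by (auto simp: card_image)
  have "E \<subseteq> pairs ?n"
    unfolding E_def pairs_def using less lt ordered_graph_edgeD[OF assms] by blast
  moreover have edge: "{x, y} \<in> edges G \<longleftrightarrow> (f x, f y) \<in> E \<or> (f y, f x) \<in> E" if "x \<in> ?V" "y \<in> ?V" for x y
  proof
    assume "{x, y} \<in> edges G"
    then show "(f x, f y) \<in> E \<or> (f y, f x) \<in> E"
      unfolding E_def using tot[OF that] by (auto simp: insert_commute)
  next
    have "{x, y} \<in> edges G" if xy: "(f x, f y) \<in> E" and "x \<in> ?V" "y \<in> ?V" for x y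
    proof -
      obtain x' y' where "f x = f x'" "f y = f y'" "{x', y'} \<in> edges G"
        using xy unfolding E_def by blast
      then show ?thesis
        using that(2,3) inj ordered_graph_edgeD[OF assms] unfolding inj_on_def by metis
    qed
    then show "(f x, f y) \<in> E \<or> (f y, f x) \<in> E \<Longrightarrow> {x, y} \<in> edges G"
      using that by (metis insert_commute)
  qed
  moreover have "ograph_iso G (std_graph ?n E)"
    unfolding ograph_iso_def
  proof (intro exI[of _ f] conjI ballI)
    show "bij_betw f ?V (verts (std_graph ?n E))" using bij by simp
    fix x y assume "x \<in> ?V" "y \<in> ?V"
    then show "((x, y) \<in> vord G) = ((f x, f y) \<in> vord (std_graph ?n E))"
      "({x, y} \<in> edges G) = ({f x, f y} \<in> edges (std_graph ?n E))"
      using ord lt edge by (auto simp: vord_std_graph edge_std_graph)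
  qed
  ultimately show ?thesis by blast
qed

text \<open>All smaller points are fixed, so the preimage of \<open>x\<close> is not below
  \<open>x\<close>, which gives \<open>f x \<le> x\<close>. If \<open>f x\<close> were smaller than
  \<open>x\<close>, it would be a fixed point, against injectivity.\<close>

lemma order_preserving_lessThan_id:
  fixes f :: "nat \<Rightarrow> nat"
  assumes bij: "bij_betw f {..<n} {..<n}"
    and ord: "\<And>x y. x < n \<Longrightarrow> y < n \<Longrightarrow> x \<le> y \<longleftrightarrow> f x \<le> f y"
  shows "x < n \<Longrightarrow> f x = x"
proof (induction x rule: less_induct)
  case (less x)
  obtain z where z: "z < n" "f z = x"
    using bij less.prems by (metis bij_betw_def imageE lessThan_iff)
  have "\<not> z < x" using less.IH[of z] z by auto
  then have "f x \<le> x" using ord[of x z] less.prems z by simp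
  moreover have "\<not> f x < x"
  proof
    assume "f x < x"
    then have "f (f x) = f x" using less by auto
    then show False
      using \<open>f x < x\<close> bij less.prems unfolding bij_betw_def inj_on_def
      by (metis lessThan_iff less_imp_neq less_trans)
  qed
  ultimately show ?case by simp
qed

text \<open>The isomorphism preserves the order of \<open>{..<n}\<close>, hence is the identity, and
  so the edges agree.\<close>

lemma std_graph_iso_eq:
  assumes "E \<subseteq> pairs n" "E' \<subseteq> pairs n" "ograph_iso (std_graph n E) (std_graph n E')"
  shows "E = E'"
proof -
  obtain f where f: "bij_betw f {..<n} {..<n}" and
    ord: "\<And>x y. x < n \<Longrightarrow> y < n \<Longrightarrow> (x \<le> y \<and> y < n) = (f x \<le> f y \<and> f y < n)" and
    edge: "\<And>x y. x < n \<Longrightarrow> y < n \<Longrightarrow>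
      ((x, y) \<in> E \<or> (y, x) \<in> E) = ((f x, f y) \<in> E' \<or> (f y, f x) \<in> E')"
    using assms(3) unfolding ograph_iso_def
    by (auto simp: vord_std_graph edge_std_graph)
  have lt: "f x < n" if "x < n" for x using f that by (auto simp: bij_betw_def)
  have fid: "f x = x" if "x < n" for x
    by (rule order_preserving_lessThan_id[OF f _ that]) (use ord lt in auto)
  have "(x, y) \<in> E \<longleftrightarrow> (x, y) \<in> E'" if "x < y" "y < n" for x y
  proof -
    have "(y, x) \<notin> E" "(y, x) \<notin> E'" using that assms(1,2) unfolding pairs_def by auto
    then show ?thesis using edge[of x y] fid[of x] fid[of y] that by simp
  qed
  then show ?thesis using assms(1,2) unfolding pairs_def by (auto dest: subsetD)
qed

definition iso_class :: "nat \<Rightarrow> (nat \<times> nat) set \<Rightarrow> nat ograph set" where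
  "iso_class n E = iso_rel `` {std_graph n E}"

lemma inj_on_iso_class: "inj_on (iso_class n) (Pow (pairs n))"
proof (rule inj_onI)
  fix E E' assume E: "E \<in> Pow (pairs n)" "E' \<in> Pow (pairs n)" "iso_class n E = iso_class n E'"
  then have "(std_graph n E, std_graph n E') \<in> iso_rel"
    using eq_equiv_class[OF _ equiv_iso_rel, of "std_graph n E" "std_graph n E'"] ordered_std_graph
    unfolding iso_class_def by auto
  then show "E = E'" using E std_graph_iso_eq unfolding iso_rel_def by auto
qed

lemma iso_class_codes_subset: "iso_class n ` codes A n \<subseteq> slice A n"
  unfolding slice_def iso_class_def codes_def by (auto intro!: quotientI)

text \<open>Every class that meets \<open>A\<close> contains a standard graph, though perhaps one
  outside \<open>A\<close>. This yields the finiteness of the slices.\<close>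

lemma slice_subset_iso_class:
  assumes "\<forall>G\<in>A. ordered_graph G"
  shows "slice A n \<subseteq> iso_class n ` Pow (pairs n)"
proof
  fix C assume "C \<in> slice A n"
  then obtain G where G: "G \<in> A" "card (verts G) = n" "C = iso_rel `` {G}"
    unfolding slice_def by (auto elim: quotientE)
  then obtain E where E: "E \<subseteq> pairs n" "ograph_iso G (std_graph n E)"
    using ex_std_graph assms by blast
  then have "(G, std_graph n E) \<in> iso_rel"
    using G assms ordered_std_graph unfolding iso_rel_def by blast
  then have "C = iso_class n E"
    using equiv_class_eq[OF equiv_iso_rel] G unfolding iso_class_def by blast
  then show "C \<in> iso_class n ` Pow (pairs n)" using E by blast
qed

lemma finite_slice:
  assumes "\<forall>G\<in>A. ordered_graph G"
  shows "finite (slice A n)"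
  by (rule finite_subset[OF slice_subset_iso_class[OF assms]]) (simp add: finite_pairs)

text \<open>Stated for arbitrary collections of ordered graphs, so that it applies directly to
  \<open>max_degree_le_1 P\<close>.\<close>

lemma card_le_speed:
  assumes "\<forall>G\<in>A. ordered_graph G" "F \<subseteq> codes A n"
  shows "card F \<le> speed A n"
proof -
  have "inj_on (iso_class n) F"
    by (rule inj_on_subset[OF inj_on_iso_class]) (use assms(2) in \<open>auto simp: codes_def\<close>)
  then have "card F = card (iso_class n ` F)" by (simp add: card_image)
  also have "\<dots> \<le> card (slice A n)"
    using iso_class_codes_subset assms(2) by (intro card_mono finite_slice assms(1)) blast
  finally show ?thesis by (simp add: speed_def)
qed

lemma speed_mono:
  assumes "A \<subseteq> B" "\<forall>G\<in>B. ordered_graph G"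
  shows "speed A n \<le> speed B n"
  unfolding speed_def
  by (rule card_mono[OF finite_slice[OF assms(2)]])
     (use assms(1) in \<open>auto simp: slice_def quotient_def\<close>)

lemma graph_property_std_graph:
  assumes "graph_property P" "ordered_graph G"
  shows "\<exists>E \<subseteq> pairs (card (verts G)).
    ograph_iso G (std_graph (card (verts G)) E) \<and> (G \<in> P \<longleftrightarrow> E \<in> codes P (card (verts G)))"
proof -
  obtain E where E: "E \<subseteq> pairs (card (verts G))" "ograph_iso G (std_graph (card (verts G)) E)"
    using ex_std_graph[OF assms(2)] by blast
  then have "G \<in> P \<longleftrightarrow> std_graph (card (verts G)) E \<in> P"
    using assms ordered_std_graph ograph_iso_sym unfolding graph_property_def by blast
  with E show ?thesis unfolding codes_def by blast
qed

text \<open>Closure under isomorphism puts the standard representative of each class into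
  \<open>P\<close> itself, and different codes give different classes.\<close>

lemma speed_eq_card_codes:
  assumes "graph_property P"
  shows "speed P n = card (codes P n)"
proof -
  have ordP: "\<forall>G\<in>P. ordered_graph G" using assms unfolding graph_property_def by blast
  have "slice P n \<subseteq> iso_class n ` codes P n"
  proof
    fix C assume "C \<in> slice P n"
    then obtain G where G: "G \<in> P" "card (verts G) = n" "C = iso_rel `` {G}"
      unfolding slice_def by (auto elim: quotientE)
    then obtain E where E: "E \<in> codes P n" "ograph_iso G (std_graph n E)"
      using graph_property_std_graph[OF assms, of G] ordP by blast
    then have "(G, std_graph n E) \<in> iso_rel"
      using G ordP unfolding iso_rel_def codes_def by blast
    then have "C = iso_class n E"
      using equiv_class_eq[OF equiv_iso_rel] G unfolding iso_class_def by blast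
    then show "C \<in> iso_class n ` codes P n" using E by blast
  qed
  then have "slice P n = iso_class n ` codes P n" using iso_class_codes_subset by blast
  moreover have "inj_on (iso_class n) (codes P n)"
    by (rule inj_on_subset[OF inj_on_iso_class]) (auto simp: codes_def)
  ultimately show ?thesis unfolding speed_def by (simp add: card_image)
qed

lemma graph_property_subset:
  assumes "graph_property P" "graph_property Q" "\<And>n. codes P n \<subseteq> codes Q n"
  shows "P \<subseteq> Q"
proof
  fix G assume "G \<in> P"
  then have G: "ordered_graph G" using assms(1) unfolding graph_property_def by blast
  obtain E where E: "ograph_iso G (std_graph (card (verts G)) E)" "E \<in> codes P (card (verts G))"
    using graph_property_std_graph[OF assms(1) G] \<open>G \<in> P\<close> by blast
  then have "std_graph (card (verts G)) E \<in> Q" using assms(3) unfolding codes_def by blast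
  then show "G \<in> Q"
    using assms(2) G ograph_iso_sym[OF E(1)] unfolding graph_property_def by blast
qed

text \<open>The image of \<open>\<phi>\<close> with the images of the edges in \<open>E\<close> is a
  subgraph of \<open>std_graph N A\<close> and, since \<open>\<phi>\<close> is strictly increasing,
  a copy of \<open>std_graph n E\<close>. Monotonicity and closure under isomorphism thus become one
  statement about sets of pairs.\<close>

lemma std_graph_embed:
  assumes P: "monotone_property P" and A: "A \<in> codes P N"
    and \<phi>: "\<And>x y. x < y \<Longrightarrow> y < n \<Longrightarrow> \<phi> x < \<phi> y" "\<And>x. x < n \<Longrightarrow> \<phi> x < N"
    and E: "E \<subseteq> pairs n" "\<And>x y. (x, y) \<in> E \<Longrightarrow> (\<phi> x, \<phi> y) \<in> A"
  shows "E \<in> codes P n"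
proof -
  let ?G = "std_graph N A" let ?V = "\<phi> ` {..<n}"
  let ?H = "\<lparr>verts = ?V, edges = (\<lambda>(i, j). {\<phi> i, \<phi> j}) ` E, vord = vord ?G \<inter> ?V \<times> ?V\<rparr>"
  have G: "?G \<in> P" "ordered_graph ?G" using A ordered_std_graph unfolding codes_def by auto
  have lt: "\<phi> x < \<phi> y \<longleftrightarrow> x < y" if "x < n" "y < n" for x y
    using \<phi>(1) that by (metis less_asym linorder_neqE_nat less_irrefl)
  have inj: "\<phi> x = \<phi> y \<longleftrightarrow> x = y" if "x < n" "y < n" for x y
    using lt that by (metis less_irrefl linorder_neqE_nat)
  have EV: "x < n \<and> y < n \<and> x < y" if "(x, y) \<in> E" for x y
    using that E(1) unfolding pairs_def by auto
  have H: "ordered_graph ?H"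
    unfolding ordered_graph_def
  proof (intro conjI ballI)
    show "finite (verts ?H)" by simp
    fix e assume "e \<in> edges ?H"
    then obtain x y where xy: "(x, y) \<in> E" "e = {\<phi> x, \<phi> y}" by auto
    show "e \<subseteq> verts ?H" using xy EV by auto
    show "card e = 2" using xy EV inj by (auto simp: card_insert_if)
  next
    have "?V \<subseteq> {..<N}" using \<phi>(2) by auto
    then show "linear_order_on (verts ?H) (vord ?H)"
      unfolding linear_order_unfold by (auto simp: vord_std_graph)
  qed
  moreover have "edges ?H \<subseteq> edges ?G" using E(2) by (auto simp: std_graph_def)
  ultimately have "subgraph ?H ?G" unfolding subgraph_def using G \<phi>(2) by auto
  then have HP: "?H \<in> P" using P G(1) unfolding monotone_property_def by blast
  have "ograph_iso (std_graph n E) ?H"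
    unfolding ograph_iso_def
  proof (intro exI[of _ \<phi>] conjI ballI)
    show "bij_betw \<phi> (verts (std_graph n E)) (verts ?H)"
      by (auto simp: bij_betw_def inj_on_def inj)
    fix x y assume "x \<in> verts (std_graph n E)" "y \<in> verts (std_graph n E)"
    then have xy: "x < n" "y < n" by auto
    show "((x, y) \<in> vord (std_graph n E)) = ((\<phi> x, \<phi> y) \<in> vord ?H)"
      using xy lt[of y x] \<phi>(2) by (auto simp: vord_std_graph not_less[symmetric])
    have "{\<phi> x, \<phi> y} \<in> edges ?H \<longleftrightarrow> (x, y) \<in> E \<or> (y, x) \<in> E"
    proof
      assume "{\<phi> x, \<phi> y} \<in> edges ?H"
      then obtain u v where "(u, v) \<in> E" "{\<phi> x, \<phi> y} = {\<phi> u, \<phi> v}" by auto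
      then show "(x, y) \<in> E \<or> (y, x) \<in> E"
        using xy EV[of u v] by (auto simp: doubleton_eq_iff inj)
    next
      assume "(x, y) \<in> E \<or> (y, x) \<in> E"
      then show "{\<phi> x, \<phi> y} \<in> edges ?H" by (auto simp: image_iff insert_commute)
    qed
    then show "({x, y} \<in> edges (std_graph n E)) = ({\<phi> x, \<phi> y} \<in> edges ?H)"
      by (simp add: edge_std_graph)
  qed
  then have "std_graph n E \<in> P"
    using P HP ordered_std_graph[OF E(1)] ograph_iso_sym
    unfolding monotone_property_def graph_property_def by blast
  then show ?thesis using E(1) unfolding codes_def by blast
qed

section \<open>The extremal property\<close>

text \<open>Matchings in which every left endpoint precedes every right endpoint: the subgraphs of the
  graphs \<open>H(\<pi>)\<close>.\<close>

definition split_graphs :: "nat ograph set" where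
  "split_graphs = {G. ordered_graph G \<and>
     (\<forall>x y u v. {x, y} \<in> edges G \<and> (x, y) \<in> vord G \<and> {u, v} \<in> edges G \<and> (u, v) \<in> vord G \<longrightarrow>
        (x, v) \<in> vord G \<and> x \<noteq> v \<and> (x = u \<longleftrightarrow> y = v))}"

text \<open>Two edges can share a left end, share a right end, or meet in a vertex that is the left
  end of one and the right end of the other. The equivalence excludes the first two for distinct
  edges, and \<open>x < v\<close> the third.\<close>

definition split_matchings :: "nat \<Rightarrow> (nat \<times> nat) set set" where
  "split_matchings n = {E. E \<subseteq> pairs n \<and>
     (\<forall>x y u v. (x, y) \<in> E \<and> (u, v) \<in> E \<longrightarrow> x < v \<and> (x = u \<longleftrightarrow> y = v))}"

lemma codes_split_graphs: "codes split_graphs n = split_matchings n"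
proof -
  have "std_graph n E \<in> split_graphs \<longleftrightarrow> E \<in> split_matchings n" if E: "E \<subseteq> pairs n" for E
  proof -
    have "{x, y} \<in> edges (std_graph n E) \<and> (x, y) \<in> vord (std_graph n E) \<longleftrightarrow> (x, y) \<in> E" for x y
      using E by (auto simp: edge_std_graph vord_std_graph pairs_def)
    moreover have "(x, y) \<in> E \<Longrightarrow> y < n" for x y using E by (auto simp: pairs_def)
    ultimately show ?thesis
      using E ordered_std_graph[OF E]
      unfolding split_graphs_def split_matchings_def mem_Collect_eq
      by (simp only: conj_assoc[symmetric] vord_std_graph) (metis less_le)
  qed
  then show ?thesis unfolding codes_def split_matchings_def by blast
qed

lemma split_graphs_iso:
  assumes G: "G \<in> split_graphs" and H: "ordered_graph H" and iso: "ograph_iso G H"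
  shows "H \<in> split_graphs"
proof -
  obtain f where f: "bij_betw f (verts H) (verts G)" and
    f_iso: "\<And>x y. x \<in> verts H \<Longrightarrow> y \<in> verts H \<Longrightarrow>
      ((x, y) \<in> vord H \<longleftrightarrow> (f x, f y) \<in> vord G) \<and> ({x, y} \<in> edges H \<longleftrightarrow> {f x, f y} \<in> edges G)"
    using ograph_iso_sym[OF iso] unfolding ograph_iso_def by blast
  have inj: "f x = f y \<longleftrightarrow> x = y" if "x \<in> verts H" "y \<in> verts H" for x y
    using f that unfolding bij_betw_def inj_on_def by blast
  have "(x, v) \<in> vord H \<and> x \<noteq> v \<and> (x = u \<longleftrightarrow> y = v)"
    if "{x, y} \<in> edges H" "(x, y) \<in> vord H" "{u, v} \<in> edges H" "(u, v) \<in> vord H" for x y u v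
  proof -
    have V: "x \<in> verts H" "y \<in> verts H" "u \<in> verts H" "v \<in> verts H"
      using that ordered_graph_edgeD[OF H] by blast+
    then have "{f x, f y} \<in> edges G" "(f x, f y) \<in> vord G" "{f u, f v} \<in> edges G" "(f u, f v) \<in> vord G"
      using that f_iso by blast+
    then have "(f x, f v) \<in> vord G \<and> f x \<noteq> f v \<and> (f x = f u \<longleftrightarrow> f y = f v)"
      using G unfolding split_graphs_def by blast
    then show ?thesis using V f_iso inj by blast
  qed
  then show ?thesis unfolding split_graphs_def using H by blast
qed

lemma monotone_split_graphs: "monotone_property split_graphs"
proof -
  have "H \<in> split_graphs" if G: "G \<in> split_graphs" and sub: "subgraph H G" for G H
  proof -
    have H: "ordered_graph H" "edges H \<subseteq> edges G" "vord H = vord G \<inter> verts H \<times> verts H"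
      using sub unfolding subgraph_def by auto
    have "(x, v) \<in> vord H \<and> x \<noteq> v \<and> (x = u \<longleftrightarrow> y = v)"
      if "{x, y} \<in> edges H" "(x, y) \<in> vord H" "{u, v} \<in> edges H" "(u, v) \<in> vord H" for x y u v
    proof -
      have "x \<in> verts H" "v \<in> verts H" using that ordered_graph_edgeD[OF H(1)] by blast+
      moreover have "(x, v) \<in> vord G \<and> x \<noteq> v \<and> (x = u \<longleftrightarrow> y = v)"
        using G that H(2,3) unfolding split_graphs_def by blast
      ultimately show ?thesis using H(3) by blast
    qed
    then show ?thesis unfolding split_graphs_def using H(1) by blast
  qed
  moreover have "graph_property split_graphs"
    unfolding graph_property_def
  proof (intro conjI ballI allI impI)
    show "ordered_graph G" if "G \<in> split_graphs" for G using that by (simp add: split_graphs_def)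
    show "H \<in> split_graphs" if "G \<in> split_graphs" "ordered_graph H \<and> ograph_iso G H" for G H
      using split_graphs_iso that by blast
  qed
  ultimately show ?thesis unfolding monotone_property_def by blast
qed

text \<open>A vertex on two edges is the left end of both or the right end of both, because no left
  end is also a right end. In either case the edges coincide.\<close>

lemma degree_split_matching:
  assumes "E \<in> split_matchings n"
  shows "degree (std_graph n E) v \<le> 1"
proof -
  let ?D = "{e \<in> edges (std_graph n E). v \<in> e}"
  have "finite E" using assms finite_pairs finite_subset unfolding split_matchings_def by blast
  then have "finite ?D" by (simp add: std_graph_def)
  moreover have "e = e'" if "e \<in> ?D" "e' \<in> ?D" for e e'
  proof -
    have "e \<in> (\<lambda>(i, j). {i, j}) ` E" "e' \<in> (\<lambda>(i, j). {i, j}) ` E"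
      using that by (auto simp: std_graph_def)
    then obtain x y x' y' where "(x, y) \<in> E" "e = {x, y}" "(x', y') \<in> E" "e' = {x', y'}"
      by fastforce
    moreover have "x < y'" "x' < y" "x = x' \<longleftrightarrow> y = y'"
      using calculation assms unfolding split_matchings_def by blast+
    ultimately show ?thesis using that by auto
  qed
  ultimately have "card ?D \<le> Suc 0" by (subst card_le_Suc0_iff_eq) blast+
  then show ?thesis by (simp add: degree_def)
qed

text \<open>Left endpoints are at most \<open>k\<close> and right endpoints exceed \<open>k\<close>,
  while injectivity of \<open>\<pi>\<close> keeps the edges disjoint. Thus every
  \<open>H(\<pi>)\<close> lies in each property that includes \<open>split_graphs\<close>.\<close>

lemma perm_graph_in_split_graphs:
  assumes "\<pi> permutes {1..k}"
  shows "perm_graph k \<pi> \<in> split_graphs"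
proof -
  have rng: "\<pi> i \<in> {1..k}" if "i \<in> {1..k}" for i
    using permutes_in_image[OF assms] that by blast
  have inj: "\<pi> i = \<pi> j \<longleftrightarrow> i = j" for i j
    using permutes_inj[OF assms] by (auto dest: injD)
  have edge: "\<exists>i\<in>{1..k}. x = i \<and> y = \<pi> i + k"
    if xy: "{x, y} \<in> edges (perm_graph k \<pi>)" and "(x, y) \<in> vord (perm_graph k \<pi>)" for x y
  proof -
    obtain i where i: "i \<in> {1..k}" "{x, y} = {i, \<pi> i + k}"
      using xy unfolding perm_graph_def by auto
    moreover have "i < \<pi> i + k" using rng[OF i(1)] i(1) by auto
    ultimately show ?thesis using that(2) unfolding perm_graph_def by (auto simp: doubleton_eq_iff)
  qed
  have "ordered_graph (perm_graph k \<pi>)"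
    unfolding ordered_graph_def
  proof (intro conjI ballI)
    show "finite (verts (perm_graph k \<pi>))" by (simp add: perm_graph_def)
    fix e assume "e \<in> edges (perm_graph k \<pi>)"
    then obtain i where i: "i \<in> {1..k}" "e = {i, \<pi> i + k}" unfolding perm_graph_def by auto
    then show "e \<subseteq> verts (perm_graph k \<pi>)" using rng[OF i(1)] by (auto simp: perm_graph_def)
    show "card e = 2" using i rng[OF i(1)] by (auto simp: card_insert_if)
  next
    show "linear_order_on (verts (perm_graph k \<pi>)) (vord (perm_graph k \<pi>))"
      unfolding perm_graph_def linear_order_unfold by auto
  qed
  moreover have "(x, v) \<in> vord (perm_graph k \<pi>) \<and> x \<noteq> v \<and> (x = u \<longleftrightarrow> y = v)"
    if e: "{x, y} \<in> edges (perm_graph k \<pi>)" "(x, y) \<in> vord (perm_graph k \<pi>)"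
       "{u, v} \<in> edges (perm_graph k \<pi>)" "(u, v) \<in> vord (perm_graph k \<pi>)" for x y u v
  proof -
    obtain i j where ij: "i \<in> {1..k}" "x = i" "y = \<pi> i + k" "j \<in> {1..k}" "u = j" "v = \<pi> j + k"
      using edge[OF e(1,2)] edge[OF e(3,4)] by blast
    then show ?thesis using rng[of j] inj by (auto simp: perm_graph_def)
  qed
  ultimately show ?thesis unfolding split_graphs_def by blast
qed

section \<open>Counting split matchings\<close>

lemma bij_betw_nth_sorted_list:
  assumes "finite S"
  shows "bij_betw ((!) (sorted_list_of_set S)) {..<card S} S"
  by (rule bij_betw_nth) (use assms in auto)

lemma nth_sorted_list_less:
  assumes "finite (S :: nat set)" "i < j" "j < card S"
  shows "sorted_list_of_set S ! i < sorted_list_of_set S ! j"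
  using assms strict_sorted_list_of_set[of S] by (simp add: sorted_wrt_iff_nth_less)

text \<open>\<open>A\<close> is closed downwards, so \<open>a \<in> A\<close> comes with
  \<open>a + 1\<close> elements of \<open>A\<close>, whence \<open>a < k\<close>. It is used below
  for the positions of the left endpoints in the sorted list of matched vertices.\<close>

lemma initial_segment_eq_lessThan:
  assumes "A \<union> B = {..<2 * k}" "card A = k" "\<And>a b. a \<in> A \<Longrightarrow> b \<in> B \<Longrightarrow> a < (b::nat)"
  shows "A = {..<k}"
proof -
  have fin: "finite A" using assms(1) by (metis finite_Un finite_lessThan)
  have "a < k" if a: "a \<in> A" for a
  proof -
    have "{..a} \<subseteq> A"
    proof
      fix b assume "b \<in> {..a}"
      moreover have "a < 2 * k" using a assms(1) by blast
      ultimately have "b \<in> A \<union> B" "b \<le> a" using assms(1) by auto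
      then show "b \<in> A" using assms(3)[OF a] by fastforce
    qed
    from card_mono[OF fin this] show ?thesis using assms(2) by simp
  qed
  then have "A \<subseteq> {..<k}" by auto
  then show ?thesis using assms(2) by (intro card_subset_eq) auto
qed

text \<open>\<open>S\<close> is the set of matched vertices. In increasing order its first half
  provides the left endpoints, its second half the right ones, and \<open>\<pi>\<close> pairs the
  two halves.\<close>

definition matching_of :: "nat \<Rightarrow> nat set \<times> (nat \<Rightarrow> nat) \<Rightarrow> (nat \<times> nat) set" where
  "matching_of k = (\<lambda>(S, \<pi>).
     (\<lambda>i. (sorted_list_of_set S ! i, sorted_list_of_set S ! (k + \<pi> i))) ` {..<k})"

lemma support_matching_of:
  assumes "finite S" "card S = 2 * k" "\<pi> permutes {..<k}"
  shows "fst ` matching_of k (S, \<pi>) \<union> snd ` matching_of k (S, \<pi>) = S"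
proof -
  let ?s = "(!) (sorted_list_of_set S)"
  have "snd ` matching_of k (S, \<pi>) = ?s ` (+) k ` \<pi> ` {..<k}"
    unfolding matching_of_def by (auto simp: image_image)
  also have "\<pi> ` {..<k} = {..<k}" by (rule permutes_image[OF assms(3)])
  also have "(+) k ` {..<k} = {k..<2 * k}"
    by (simp add: lessThan_atLeast0 image_add_atLeastLessThan mult_2)
  finally have snd: "snd ` matching_of k (S, \<pi>) = ?s ` {k..<2 * k}" .
  have "fst ` matching_of k (S, \<pi>) = ?s ` {..<k}"
    unfolding matching_of_def by (auto simp: image_image)
  moreover have "{..<k} \<union> {k..<2 * k} = {..<card S}" using assms(2) by auto
  ultimately show ?thesis
    using snd bij_betw_nth_sorted_list[OF assms(1)]
    by (metis bij_betw_imp_surj_on image_Un)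
qed

text \<open>The choice of \<open>S\<close> accounts for the binomial coefficient and that of
  \<open>\<pi>\<close> for the factorial. A matching determines \<open>S\<close> as the set of its
  endpoints and then \<open>\<pi>\<close> by its edges. Conversely, in a split matching with
  \<open>k\<close> edges the left endpoints are the \<open>k\<close> smallest matched vertices, so a
  permutation can be read off.\<close>

lemma bij_betw_matching_of:
  "bij_betw (matching_of k)
     ({S. S \<subseteq> {..<n} \<and> card S = 2 * k} \<times> {\<pi>. \<pi> permutes {..<k}})
     {E \<in> split_matchings n. card E = k}"
  (is "bij_betw _ (?\<S> \<times> ?\<Pi>) ?M")
proof (rule bij_betw_imageI)
  have fin: "finite S" if "S \<in> ?\<S>" for S using that finite_subset by blast
  have inj: "sorted_list_of_set S ! i = sorted_list_of_set S ! j \<longleftrightarrow> i = j"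
    if "S \<in> ?\<S>" "i < 2 * k" "j < 2 * k" for S i j
    using that bij_betw_nth_sorted_list[OF fin[OF that(1)]]
    by (auto simp: bij_betw_def inj_on_def)
  have lt: "\<pi> i < k" if "\<pi> \<in> ?\<Pi>" "i < k" for \<pi> i
    using that permutes_in_image[of \<pi> "{..<k}" i] by simp
  show "inj_on (matching_of k) (?\<S> \<times> ?\<Pi>)"
  proof (rule inj_onI)
    fix p p' assume p: "p \<in> ?\<S> \<times> ?\<Pi>" "p' \<in> ?\<S> \<times> ?\<Pi>" "matching_of k p = matching_of k p'"
    obtain S \<pi> S' \<pi>' where pp: "p = (S, \<pi>)" "p' = (S', \<pi>')" by (metis surj_pair)
    have S: "S \<subseteq> {..<n}" "card S = 2 * k" "S' \<subseteq> {..<n}" "card S' = 2 * k"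
      and \<pi>: "\<pi> permutes {..<k}" "\<pi>' permutes {..<k}"
      and eq: "matching_of k (S, \<pi>) = matching_of k (S', \<pi>')"
      using p unfolding pp by auto
    have "finite S" "finite S'" using S finite_subset by blast+
    then have "S = S'"
      using support_matching_of[OF _ S(2) \<pi>(1)] support_matching_of[OF _ S(4) \<pi>(2)] eq
      by simp
    moreover have "\<pi> i = \<pi>' i" for i
    proof (cases "i < k")
      case True
      let ?s = "(!) (sorted_list_of_set S)"
      have "(?s i, ?s (k + \<pi> i)) \<in> matching_of k (S, \<pi>')"
        using True eq \<open>S = S'\<close> unfolding matching_of_def by auto
      then obtain i' where i': "i' < k" "?s i = ?s i'" "?s (k + \<pi> i) = ?s (k + \<pi>' i')"
        unfolding matching_of_def by auto
      have "i = i'" using i' True inj[of S i i'] S by simp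
      moreover have "k + \<pi> i = k + \<pi>' i'"
        using i' True inj[of S "k + \<pi> i" "k + \<pi>' i'"] S lt[of \<pi> i] lt[of \<pi>' i'] \<pi> by simp
      ultimately show ?thesis by simp
    next
      case False
      then show ?thesis using \<pi> by (simp add: permutes_def)
    qed
    ultimately show "p = p'" unfolding pp by auto
  qed
  show "matching_of k ` (?\<S> \<times> ?\<Pi>) = ?M"
  proof (intro equalityI subsetI)
    fix E assume "E \<in> matching_of k ` (?\<S> \<times> ?\<Pi>)"
    then obtain S \<pi> where S: "S \<in> ?\<S>" and \<pi>: "\<pi> \<in> ?\<Pi>" and E: "E = matching_of k (S, \<pi>)" by auto
    let ?s = "(!) (sorted_list_of_set S)"
    have less: "?s i < ?s (k + \<pi> j)" if "i < k" "j < k" for i j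
      by (rule nth_sorted_list_less[OF fin[OF S]]) (use that S lt[OF \<pi>] in \<open>auto simp: mult_2\<close>)
    have bound: "?s i < n" if "i < 2 * k" for i
      using that S bij_betw_nth_sorted_list[OF fin[OF S]]
      by (metis (mono_tags, lifting) bij_betwE lessThan_iff mem_Collect_eq subsetD)
    have \<pi>_inj: "\<pi> i = \<pi> j \<longleftrightarrow> i = j" for i j
      using \<pi> permutes_inj[of \<pi>] by (auto dest: injD)
    have inj_l: "?s i = ?s j \<longleftrightarrow> i = j" if "i < k" "j < k" for i j
      using that by (intro inj[OF S]) auto
    have inj_r: "?s (k + \<pi> i) = ?s (k + \<pi> j) \<longleftrightarrow> i = j" if "i < k" "j < k" for i j
      using inj[OF S, of "k + \<pi> i" "k + \<pi> j"] that lt[OF \<pi>, of i] lt[OF \<pi>, of j] \<pi>_inj by simp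
    have "E \<subseteq> pairs n"
      unfolding E matching_of_def pairs_def using less bound lt[OF \<pi>] by (auto simp: mult_2)
    moreover have "x < v \<and> (x = u \<longleftrightarrow> y = v)" if xy: "(x, y) \<in> E" and uv: "(u, v) \<in> E" for x y u v
    proof -
      obtain i where "i < k" "x = ?s i" "y = ?s (k + \<pi> i)"
        using xy unfolding E matching_of_def by auto
      moreover obtain j where "j < k" "u = ?s j" "v = ?s (k + \<pi> j)"
        using uv unfolding E matching_of_def by auto
      ultimately show ?thesis using less inj_l inj_r by simp
    qed
    moreover have "card E = k"
      unfolding E matching_of_def using inj_l by (simp add: card_image inj_on_def)
    ultimately show "E \<in> ?M" unfolding split_matchings_def by blast
  next
    fix E assume "E \<in> ?M"
    then have E: "E \<subseteq> pairs n" "card E = k"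
      and split: "\<And>x y u v. (x, y) \<in> E \<Longrightarrow> (u, v) \<in> E \<Longrightarrow> x < v \<and> (x = u \<longleftrightarrow> y = v)"
      unfolding split_matchings_def by blast+
    have finE: "finite E" using E(1) finite_pairs finite_subset by blast
    let ?L = "fst ` E" and ?R = "snd ` E"
    let ?S = "?L \<union> ?R" let ?s = "(!) (sorted_list_of_set ?S)"
    have LR: "x < y" if "x \<in> ?L" "y \<in> ?R" for x y using that split by fastforce
    have "inj_on fst E" "inj_on snd E" using split by (force simp: inj_on_def)+
    then have card_LR: "card ?L = k" "card ?R = k" using E(2) by (auto simp: card_image)
    have "?L \<inter> ?R = {}" using LR by blast
    then have card_S: "card ?S = 2 * k" using card_LR finE by (simp add: card_Un_disjoint)
    have "?S \<subseteq> {..<n}" using E(1) unfolding pairs_def by auto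
    then have S: "?S \<in> ?\<S>" using card_S by simp
    have bij: "bij_betw ?s {..<2 * k} ?S" using bij_betw_nth_sorted_list[OF fin[OF S]] card_S by simp
    let ?I = "{i \<in> {..<2 * k}. ?s i \<in> ?L}" and ?J = "{i \<in> {..<2 * k}. ?s i \<in> ?R}"
    have "f ` {i \<in> A. f i \<in> B} = B" if "B \<subseteq> f ` A" for f :: "nat \<Rightarrow> nat" and A B
      using that by blast
    from this[of ?L ?s "{..<2 * k}"] have "?s ` ?I = ?L"
      using bij_betw_imp_surj_on[OF bij] by simp
    then have "bij_betw ?s ?I ?L" using bij by (auto simp: bij_betw_def inj_on_def)
    from bij_betw_same_card[OF this] have card_I: "card ?I = k" using card_LR by simp
    have "?s i \<in> ?S" if "i < 2 * k" for i using bij_betw_apply[OF bij] that by simp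
    then have IJ: "?I \<union> ?J = {..<2 * k}" by blast
    have "i < j" if "i \<in> ?I" "j \<in> ?J" for i j
    proof (rule ccontr)
      assume "\<not> i < j"
      moreover have "?s i < ?s j" by (rule LR) (use that in auto)
      ultimately have "j < i" by (cases "i = j") auto
      moreover have "i < card ?S" using that(1) card_S by simp
      ultimately show False
        using nth_sorted_list_less[OF fin[OF S], of j i] \<open>?s i < ?s j\<close> by simp
    qed
    \<comment> \<open>\<open>?I\<close> and \<open>?J\<close> are the positions of left and right
      endpoints among the sorted matched vertices.\<close>
    with IJ card_I have I: "?I = {..<k}" by (rule initial_segment_eq_lessThan)
    have "\<exists>j<k. (?s i, ?s (k + j)) \<in> E" if i: "i < k" for i
    proof -
      have "i \<in> ?I" unfolding I using i by simp
      then have "?s i \<in> ?L" by simp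
      then obtain y where y: "(?s i, y) \<in> E" by (metis imageE prod.collapse)
      then have yR: "y \<in> ?R" by force
      then have "y \<in> ?s ` {..<2 * k}" using bij_betw_imp_surj_on[OF bij] by simp
      then obtain j where j: "j < 2 * k" "y = ?s j" by auto
      have "?s j \<notin> ?L" using yR \<open>?L \<inter> ?R = {}\<close> unfolding j(2) by (meson disjoint_iff)
      then have "j \<notin> ?I" by simp
      then have "k \<le> j" unfolding I by simp
      then show ?thesis using y j by (intro exI[of _ "j - k"]) auto
    qed
    then obtain p where p: "\<And>i. i < k \<Longrightarrow> p i < k \<and> (?s i, ?s (k + p i)) \<in> E" by metis
    \<comment> \<open>Outside \<open>{..<k}\<close> the identity is forced by
      \<open>permutes\<close>.\<close>
    define \<pi> where "\<pi> i = (if i < k then p i else i)" for i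
    have "inj_on \<pi> {..<k}"
    proof (rule inj_onI)
      fix i j assume ij: "i \<in> {..<k}" "j \<in> {..<k}" "\<pi> i = \<pi> j"
      then have "(?s i, ?s (k + p i)) \<in> E" "(?s j, ?s (k + p i)) \<in> E"
        using p[of i] p[of j] unfolding \<pi>_def by auto
      then show "i = j" using split inj[OF S, of i j] ij by auto
    qed
    moreover have "\<pi> ` {..<k} \<subseteq> {..<k}" unfolding \<pi>_def using p by auto
    ultimately have "bij_betw \<pi> {..<k} {..<k}"
      unfolding bij_betw_def by (simp add: endo_inj_surj)
    then have \<pi>: "\<pi> permutes {..<k}" by (rule bij_imp_permutes) (simp add: \<pi>_def)
    \<comment> \<open>One inclusion suffices, as both matchings have \<open>k\<close> edges.\<close>
    have sub: "matching_of k (?S, \<pi>) \<subseteq> E" unfolding matching_of_def \<pi>_def using p by auto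
    moreover have "card (matching_of k (?S, \<pi>)) = k"
    proof -
      have "inj_on (\<lambda>i. (?s i, ?s (k + \<pi> i))) {..<k}"
        using inj[OF S] by (auto simp: inj_on_def)
      then show ?thesis unfolding matching_of_def by (simp add: card_image)
    qed
    ultimately have "matching_of k (?S, \<pi>) = E" using card_subset_eq[OF finE sub] E(2) by simp
    moreover have "(?S, \<pi>) \<in> ?\<S> \<times> ?\<Pi>" using S \<pi> by blast
    ultimately show "E \<in> matching_of k ` (?\<S> \<times> ?\<Pi>)" by (metis (no_types, lifting) imageI)
  qed
qed

lemma card_split_matchings: "card (split_matchings n) = matching_sum n"
proof -
  let ?M = "\<lambda>k. {E \<in> split_matchings n. card E = k}"
  have fin: "finite (split_matchings n)"
    by (rule finite_subset[of _ "Pow (pairs n)"]) (auto simp: split_matchings_def finite_pairs)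
  have card_M: "card (?M k) = (n choose (2 * k)) * fact k" for k
    using bij_betw_same_card[OF bij_betw_matching_of, of n k]
    by (simp add: card_cartesian_product n_subsets card_permutations)
  \<comment> \<open>The bound is read off from the count itself: a nonempty class has a nonzero
    binomial coefficient.\<close>
  have "k \<le> n div 2" if "E \<in> ?M k" for E k
  proof -
    have "card (?M k) > 0" using that fin card_gt_0_iff by fastforce
    then show ?thesis unfolding card_M by (auto simp: zero_less_binomial_iff)
  qed
  then have "split_matchings n = (\<Union>k\<in>{0..n div 2}. ?M k)" by auto
  also have "card \<dots> = (\<Sum>k\<in>{0..n div 2}. card (?M k))"
    by (rule card_UN_disjoint) (use fin in auto)
  also have "\<dots> = matching_sum n" unfolding card_M matching_sum_def ..
  finally show ?thesis .
qed

section \<open>Growth of the speed\<close>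

text \<open>The summand for the largest possible number of edges alone is this large.\<close>

lemma fact_le_matching_sum: "fact (n div 2) \<le> matching_sum n"
proof -
  have "(n choose (2 * (n div 2))) * fact (n div 2) \<le> matching_sum n"
    unfolding matching_sum_def by (rule member_le_sum) auto
  moreover have "1 \<le> n choose (2 * (n div 2))" by (simp add: Suc_le_eq zero_less_binomial_iff)
  ultimately show ?thesis by (metis (no_types, lifting) le_trans mult.left_neutral mult_le_mono1)
qed

lemma real_fact_le_matching_sum: "fact (n div 2) \<le> real (matching_sum n)"
  using fact_le_matching_sum[of n] by (metis of_nat_fact of_nat_le_iff)

text \<open>Each factorial is at most \<open>n ^ (n div 2)\<close>, and the binomial coefficients
  with even lower index sum to at most \<open>2 ^ n\<close>.\<close>

lemma matching_sum_le:
  assumes "n \<ge> 1"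
  shows "matching_sum n \<le> 2 ^ n * n ^ (n div 2)"
proof -
  have "matching_sum n \<le> (\<Sum>k = 0..n div 2. (n choose (2 * k)) * n ^ (n div 2))"
    unfolding matching_sum_def
  proof (intro sum_mono mult_left_mono)
    fix k assume k: "k \<in> {0..n div 2}"
    have "fact k \<le> (k ^ k :: nat)" using fact_le_power[of k, where 'a=nat] by simp
    also have "\<dots> \<le> n ^ k" using k by (intro power_mono) auto
    also have "\<dots> \<le> n ^ (n div 2)" using k assms by (intro power_increasing) auto
    finally show "fact k \<le> n ^ (n div 2)" .
  qed simp
  also have "\<dots> = (\<Sum>j\<in>(*) 2 ` {0..n div 2}. n choose j) * n ^ (n div 2)"
    by (subst sum.reindex) (auto simp: inj_on_def sum_distrib_right)
  also have "\<dots> \<le> (\<Sum>j\<le>n. n choose j) * n ^ (n div 2)"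
    by (intro mult_right_mono sum_mono2) auto
  finally show ?thesis by (simp add: choose_row_sum)
qed

lemma power_over_fact_le_exp:
  assumes "x \<ge> (0::real)"
  shows "x ^ k / fact k \<le> exp x"
proof -
  have "(\<Sum>n\<in>{k}. x ^ n /\<^sub>R fact n) \<le> (\<Sum>n. x ^ n /\<^sub>R fact n)"
    by (rule sum_le_suminf[OF summable_exp_generic]) (use assms in auto)
  then show ?thesis by (simp add: exp_def field_simps)
qed

text \<open>A weak form of Stirling's formula: the term of index \<open>k\<close> in the exponential
  series at \<open>k\<close> is at most the whole sum.\<close>

lemma ln_fact_ge:
  assumes "k \<ge> 1"
  shows "real k * ln (real k) - real k \<le> ln (fact k)"
proof -
  have "real k ^ k \<le> exp (real k) * fact k"
    using power_over_fact_le_exp[of "real k" k] by (simp add: field_simps)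
  then have "ln (real k ^ k) \<le> ln (exp (real k) * fact k)"
    using assms by (intro ln_mono) auto
  then show ?thesis using assms by (simp add: ln_mult ln_realpow)
qed

text \<open>The upper bound comes from \<open>matching_sum_le\<close>, the lower one from the single
  factorial of \<open>n div 2\<close>. An error linear in \<open>n\<close> suffices, since it is
  divided by \<open>ln n\<close> in the exponent.\<close>

lemma ln_matching_sum_bound:
  assumes "n \<ge> 2"
  shows "\<bar>ln (matching_sum n) - real n / 2 * ln n\<bar> \<le> 2 * real n"
proof -
  let ?k = "n div 2"
  have k: "?k \<ge> 1" "real n \<le> 3 * real ?k" "(real n - 1) / 2 \<le> real ?k" "real ?k \<le> real n / 2"
  proof -
    have half: "x \<le> 3 * y" "(x - 1) / 2 \<le> y" "y \<le> x / 2"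
      if "x = 2 * y + z" "0 \<le> z" "z \<le> 1" "1 \<le> y" for x y z :: real
      using that by auto
    show k1: "?k \<ge> 1" using assms by linarith
    have "real n = 2 * real ?k + real (n mod 2)"
      by (metis mult_div_mod_eq of_nat_add of_nat_mult of_nat_numeral)
    moreover have "real (n mod 2) \<le> 1" by simp
    ultimately show "real n \<le> 3 * real ?k" "(real n - 1) / 2 \<le> real ?k" "real ?k \<le> real n / 2"
      using half[of "real n" "real ?k" "real (n mod 2)"] k1 by simp_all
  qed
  have ln0: "0 \<le> ln (real n)" "ln (real n) \<le> real n"
    using assms ln_le_minus_one[of "real n"] by auto
  have pos: "1 \<le> matching_sum n" using fact_le_matching_sum[of n] fact_ge_1[of ?k, where 'a=nat] by linarith
  have "real (matching_sum n) \<le> 2 ^ n * real n ^ ?k"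
    using matching_sum_le[of n] assms
    by (metis (mono_tags, lifting) le_trans of_nat_le_iff of_nat_mult of_nat_numeral of_nat_power
        one_le_numeral)
  then have "ln (matching_sum n) \<le> ln (2 ^ n * real n ^ ?k)"
    using pos by (intro ln_mono) auto
  also have "\<dots> = real n * ln 2 + real ?k * ln n"
    using assms by (simp add: ln_mult ln_realpow)
  also have "\<dots> \<le> real n * 1 + real n / 2 * ln n"
    by (intro add_mono mult_left_mono mult_right_mono k ln0) (use ln_2_less_1 in auto)
  finally have upper: "ln (matching_sum n) - real n / 2 * ln n \<le> 2 * real n" by simp
  have "ln (real n) \<le> ln (3 * real ?k)" using k assms by (intro ln_mono) auto
  also have "\<dots> = ln 3 + ln (real ?k)" using k(1) by (subst ln_mult) auto
  also have "ln (3::real) \<le> 2" using ln_le_minus_one[of "3::real"] by simp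
  finally have lnk: "ln (real n) - 2 \<le> ln (real ?k)" by simp
  \<comment> \<open>Replacing \<open>ln ?k\<close> by \<open>ln n - 2\<close> and the linear term of
    Stirling's bound together cost \<open>3 * ?k\<close>. The parity of \<open>n\<close> costs
    another \<open>ln n / 2\<close>, and the total stays below \<open>2 * n\<close> because
    \<open>ln n \<le> n\<close>.\<close>
  have "(real n - 1) / 2 * ln n - 3 * (real n / 2) \<le> real ?k * ln n - 3 * real ?k"
    by (intro diff_mono mult_right_mono mult_left_mono k ln0) auto
  also have "\<dots> = real ?k * (ln n - 2) - real ?k" by (simp add: algebra_simps)
  also have "\<dots> \<le> real ?k * ln ?k - real ?k"
    by (intro diff_right_mono mult_left_mono lnk) auto
  also have "\<dots> \<le> ln (fact ?k)" by (rule ln_fact_ge[OF k(1)])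
  also have "\<dots> \<le> ln (matching_sum n)"
    using real_fact_le_matching_sum[of n] by (intro ln_mono) auto
  finally have "(real n - 1) / 2 * ln n - 3 * (real n / 2) \<le> ln (matching_sum n)" .
  moreover have "(real n - 1) / 2 * ln n = real n / 2 * ln n - ln n / 2" by (simp add: field_simps)
  ultimately have "- (2 * real n) \<le> ln (matching_sum n) - real n / 2 * ln n" using ln0(2) by linarith
  with upper show ?thesis by linarith
qed

lemma matching_sum_asymptotics:
  "\<exists>\<epsilon> :: nat \<Rightarrow> real. \<epsilon> \<in> o(\<lambda>n. real n) \<and>
     (\<forall>n\<ge>1. real (matching_sum n) = real n powr (real n / 2 + \<epsilon> n))"
proof -
  \<comment> \<open>The required equation solved for the error. For \<open>n = 1\<close> the
    denominator vanishes, but both sides of the equation are 1 for any exponent.\<close>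
  define \<epsilon> where "\<epsilon> n = ln (matching_sum n) / ln n - real n / 2" for n :: nat
  have pos: "0 < matching_sum n" for n
    using fact_le_matching_sum[of n] fact_gt_zero[of "n div 2", where 'a=nat] by linarith
  have "real (matching_sum n) = real n powr (real n / 2 + \<epsilon> n)" if "n \<ge> 1" for n
  proof (cases "n = 1")
    case True
    then show ?thesis by (simp add: matching_sum_def)
  next
    case False
    then have "ln (real n) > 0" using that by simp
    then show ?thesis using that pos[of n] by (simp add: powr_def \<epsilon>_def)
  qed
  moreover have "\<epsilon> \<in> o(\<lambda>n. real n)"
  proof (rule landau_o.smallI)
    fix c :: real assume c: "c > 0"
    have "filterlim (\<lambda>n. ln (real n)) at_top sequentially"
      by (rule filterlim_compose[OF ln_at_top filterlim_real_sequentially])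
    then have "eventually (\<lambda>n. 2 / c \<le> ln (real n)) sequentially"
      by (simp add: filterlim_at_top)
    with eventually_ge_at_top[of 2]
    show "eventually (\<lambda>n. norm (\<epsilon> n) \<le> c * norm (real n)) sequentially"
    proof eventually_elim
      case (elim n)
      have ln: "ln (real n) > 0" using elim(1) by simp
      then have "\<epsilon> n * ln n = ln (matching_sum n) - real n / 2 * ln n"
        by (simp add: \<epsilon>_def field_simps)
      then have "\<bar>\<epsilon> n\<bar> * ln n \<le> 2 * real n"
        using ln_matching_sum_bound[OF elim(1)] ln by (simp flip: abs_mult_pos)
      also have "\<dots> \<le> c * real n * ln n"
      proof -
        have "2 \<le> c * ln n" using elim(2) c by (simp add: field_simps)
        then have "2 * real n \<le> c * ln n * real n" by (rule mult_right_mono) simp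
        then show ?thesis by (simp add: mult_ac)
      qed
      finally show ?case using ln by simp
    qed
  qed
  ultimately show ?thesis by blast
qed

text \<open>At \<open>2 * k\<close> vertices the speed is at least \<open>fact k\<close>, which
  exceeds \<open>(c ^ 2) ^ k\<close> for some \<open>k\<close>. This makes the structural result
  available to any property with the extremal speed.\<close>

lemma superexponential_if_speed_ge:
  assumes "\<And>n. speed P n \<ge> matching_sum n"
  shows "superexponential P"
  unfolding superexponential_def
proof (intro allI impI)
  fix c :: real assume c: "c > 0"
  have "(\<lambda>n. (c ^ 2) ^ n /\<^sub>R fact n) \<longlonglongrightarrow> 0"
    by (rule summable_LIMSEQ_zero[OF summable_exp_generic])
  then have "eventually (\<lambda>k. (c ^ 2) ^ k /\<^sub>R fact k < 1) sequentially"
    by (rule order_tendstoD(2)) simp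
  then obtain k where "(c ^ 2) ^ k /\<^sub>R fact k < 1"
    by (meson eventually_happens' sequentially_bot)
  then have "(c ^ 2) ^ k < fact k" by (simp add: field_simps)
  then have "c ^ (2 * k) < fact k" unfolding power_mult .
  also have "(fact k :: real) \<le> matching_sum (2 * k)"
    using real_fact_le_matching_sum[of "2 * k"] by simp
  also have "\<dots> \<le> speed P (2 * k)" using assms by simp
  finally show "\<exists>N. real (speed P N) > c ^ N" by blast
qed

section \<open>Superexponential properties\<close>

text \<open>Otherwise all codes would be gridless, and the speed would be bounded by an exponential
  function.\<close>

lemma superexponential_has_grid:
  assumes "graph_property P" "superexponential P" "k \<ge> 2"
  shows "\<exists>N. \<exists>A \<in> codes P N. grid k A"
proof (rule ccontr)
  assume no_grid: "\<not> ?thesis"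
  obtain c :: nat where c: "c > 0" "\<And>n. card (gridless k n) \<le> c ^ n"
    using gridless_exponential[OF assms(3)] by blast
  obtain N where N: "real (speed P N) > real c ^ N"
    using assms(2) c(1) unfolding superexponential_def by (metis of_nat_0_less_iff)
  have "pairs N \<subseteq> {..<N} \<times> {..<N}" unfolding pairs_def by auto
  then have "codes P N \<subseteq> gridless k N"
    using no_grid unfolding codes_def gridless_def by blast
  then have "speed P N \<le> card (gridless k N)"
    unfolding speed_eq_card_codes[OF assms(1)] by (rule card_mono[OF finite_gridless])
  also have "\<dots> \<le> c ^ N" by (rule c(2))
  finally have "real (speed P N) \<le> real (c ^ N)" by (rule of_nat_mono)
  with N show False by simp
qed

text \<open>Left vertices use the rows of grid points and right vertices the columns, the two ends of an
  edge those of a common point. The additional row \<open>n + 1\<close> and column \<open>0\<close> of the grid separate the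
  two kinds, because points of \<open>A\<close> lie above the diagonal.\<close>

lemma split_matching_embeds_in_grid:
  assumes A: "A \<subseteq> pairs N" and grid: "grid (n + 2) A" and E: "E \<in> split_matchings n"
  shows "\<exists>\<phi>. (\<forall>x y. x < y \<longrightarrow> y < n \<longrightarrow> \<phi> x < \<phi> y) \<and> (\<forall>x<n. \<phi> x < N) \<and>
    (\<forall>x y. (x, y) \<in> E \<longrightarrow> (\<phi> x, \<phi> y) \<in> A)"
proof -
  obtain r c where
    mem: "\<And>i j. i < n + 2 \<Longrightarrow> j < n + 2 \<Longrightarrow> (r i j, c i j) \<in> A" and
    ord: "\<And>i j i' j'. i < n + 2 \<Longrightarrow> j < n + 2 \<Longrightarrow> i' < n + 2 \<Longrightarrow> j' < n + 2 \<Longrightarrow>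
      (i < i' \<longrightarrow> r i j < r i' j') \<and> (j < j' \<longrightarrow> c i j < c i' j')"
    using grid unfolding grid_def by metis
  have E_less: "x < y" "x < n" "y < n" if "(x, y) \<in> E" for x y
  proof -
    have "(x, y) \<in> pairs n" using E that unfolding split_matchings_def by blast
    then show "x < y" "x < n" "y < n" unfolding pairs_def by auto
  qed
  have split: "x < v" "x = u \<longleftrightarrow> y = v" if "(x, y) \<in> E" "(u, v) \<in> E" for x y u v
    using E that unfolding split_matchings_def by blast+
  \<comment> \<open>\<open>g\<close> and \<open>h\<close> send the endpoints of an edge to each
    other. Where there is no partner the value is arbitrary, but the bound \<open>n\<close> keeps it
    inside the grid after the shift by one.\<close>
  have "\<exists>y\<le>n. \<forall>y'. (x, y') \<in> E \<longrightarrow> y' = y" for x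
    by (cases "\<exists>y. (x, y) \<in> E") (use split E_less less_imp_le in blast)+
  then obtain g where g: "\<And>x. g x \<le> n" "\<And>x y. (x, y) \<in> E \<Longrightarrow> y = g x" by metis
  have "\<exists>x\<le>n. \<forall>x'. (x', y) \<in> E \<longrightarrow> x' = x" for y
    by (cases "\<exists>x. (x, y) \<in> E") (use split E_less less_imp_le in blast)+
  then obtain h where h: "\<And>y. h y \<le> n" "\<And>x y. (x, y) \<in> E \<Longrightarrow> x = h y" by metis
  \<comment> \<open>Unmatched vertices are assigned to a side as well, in such a way that the left
    vertices form an initial segment.\<close>
  define left where "left x \<longleftrightarrow> (\<exists>u v. (u, v) \<in> E \<and> x \<le> u)" for x
  \<comment> \<open>Columns are shifted by one to keep column 0 free. For an edge from
    \<open>x\<close> to \<open>y\<close>, both values come from the grid point with indices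
    \<open>x\<close> and \<open>Suc y\<close>.\<close>
  define \<phi> where "\<phi> x = (if left x then r x (Suc (g x)) else c (h x) (Suc x))" for x
  have "\<phi> x < \<phi> y" if xy: "x < y" "y < n" for x y
  proof -
    consider "left x" "left y" | "left x" "\<not> left y" | "\<not> left x" "\<not> left y"
      using xy(1) unfolding left_def by (meson le_trans less_imp_le)
    then show ?thesis
    proof cases
      case 1
      then show ?thesis
        using ord[of x "Suc (g x)" y "Suc (g y)"] g(1)[of x] g(1)[of y] xy by (simp add: \<phi>_def)
    next
      case 2
      have "r x (Suc (g x)) < r (n + 1) 0" using ord[of x "Suc (g x)" "n + 1" 0] g(1)[of x] xy by simp
      also have "\<dots> < c (n + 1) 0" using mem[of "n + 1" 0] A unfolding pairs_def by auto
      also have "\<dots> < c (h y) (Suc y)" using ord[of "n + 1" 0 "h y" "Suc y"] h(1)[of y] xy by simp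
      finally show ?thesis using 2 by (simp add: \<phi>_def)
    next
      case 3
      then show ?thesis
        using ord[of "h x" "Suc x" "h y" "Suc y"] h(1)[of x] h(1)[of y] xy by (simp add: \<phi>_def)
    qed
  qed
  moreover have "\<phi> x < N" if "x < n" for x
  proof -
    have "(r x (Suc (g x)), c x (Suc (g x))) \<in> pairs N" "(r (h x) (Suc x), c (h x) (Suc x)) \<in> pairs N"
      using mem[of x "Suc (g x)"] mem[of "h x" "Suc x"] g(1)[of x] h(1)[of x] that A by auto
    then show ?thesis by (simp add: \<phi>_def pairs_def)
  qed
  moreover have "(\<phi> x, \<phi> y) \<in> A" if xy: "(x, y) \<in> E" for x y
  proof -
    have "left x" "\<not> left y" using xy split(1) unfolding left_def by (auto simp: not_le)
    moreover have "g x = y" "h y = x" using g(2)[OF xy] h(2)[OF xy] by simp_all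
    ultimately show ?thesis
      using mem[of x "Suc y"] E_less[OF xy] by (simp add: \<phi>_def)
  qed
  ultimately show ?thesis by blast
qed

lemma split_matchings_subset_codes:
  assumes "monotone_property P" "superexponential P"
  shows "split_matchings n \<subseteq> codes P n"
proof
  fix E assume E: "E \<in> split_matchings n"
  have "graph_property P" using assms(1) unfolding monotone_property_def by blast
  then obtain N A where A: "A \<in> codes P N" "grid (n + 2) A"
    using superexponential_has_grid[of P "n + 2"] assms(2) by auto
  then have "A \<subseteq> pairs N" unfolding codes_def by blast
  from split_matching_embeds_in_grid[OF this A(2) E] obtain \<phi> where
    \<phi>: "\<And>x y. x < y \<Longrightarrow> y < n \<Longrightarrow> \<phi> x < \<phi> y" "\<And>x. x < n \<Longrightarrow> \<phi> x < N"
      "\<And>x y. (x, y) \<in> E \<Longrightarrow> (\<phi> x, \<phi> y) \<in> A" by blast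
  have E_pairs: "E \<subseteq> pairs n" using E unfolding split_matchings_def by blast
  show "E \<in> codes P n"
    by (rule std_graph_embed[OF assms(1) A(1), where n = n and \<phi> = \<phi>]) (fact \<phi> E_pairs)+
qed

text \<open>The split matchings found in \<open>P\<close> all have maximum degree at most 1, so they
  are already counted by the smaller speed.\<close>

lemma matching_sum_le_speed_max_degree:
  assumes "monotone_property P" "superexponential P"
  shows "matching_sum n \<le> speed (max_degree_le_1 P) n"
proof -
  have "split_matchings n \<subseteq> codes (max_degree_le_1 P) n"
  proof
    fix E assume E: "E \<in> split_matchings n"
    then have "E \<in> codes P n" using split_matchings_subset_codes[OF assms] by blast
    then show "E \<in> codes (max_degree_le_1 P) n"
      using degree_split_matching[OF E] unfolding codes_def max_degree_le_1_def by simp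
  qed
  moreover have "\<forall>G\<in>max_degree_le_1 P. ordered_graph G"
    using assms(1) unfolding monotone_property_def graph_property_def max_degree_le_1_def by blast
  ultimately show ?thesis using card_le_speed card_split_matchings by metis
qed

lemma speed_split_graphs: "speed split_graphs n = matching_sum n"
  using speed_eq_card_codes[of split_graphs] monotone_split_graphs
  by (simp add: monotone_property_def codes_split_graphs card_split_matchings)

text \<open>The speed makes \<open>Q\<close> superexponential, so its codes include all split
  matchings. Both finite sets have the same cardinality for each \<open>n\<close>, hence they agree,
  and the codes determine the property.\<close>

lemma eq_split_graphs_if_speed_eq:
  assumes Q: "monotone_property Q" and speed: "\<And>n. speed Q n = matching_sum n"
  shows "Q = split_graphs"
proof -
  have gp: "graph_property Q" "graph_property split_graphs"
    using Q monotone_split_graphs unfolding monotone_property_def by blast+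
  have "superexponential Q" by (rule superexponential_if_speed_ge) (simp add: speed)
  then have "split_matchings n \<subseteq> codes Q n" for n by (rule split_matchings_subset_codes[OF Q])
  moreover have "card (codes Q n) = card (split_matchings n)" for n
    using speed speed_eq_card_codes[OF gp(1)] card_split_matchings by simp
  ultimately have "codes Q n = codes split_graphs n" for n
    using card_subset_eq[OF finite_codes] unfolding codes_split_graphs by metis
  then show ?thesis
    using graph_property_subset[OF gp] graph_property_subset[OF gp(2) gp(1)] by blast
qed

theorem theorem4:
  shows
    "(\<forall>P. monotone_property P \<and> superexponential P \<longrightarrow>
        (\<forall>k \<pi>. \<pi> permutes {1..k} \<longrightarrow> perm_graph k \<pi> \<in> P) \<and>
        (\<forall>n. speed P n \<ge> speed (max_degree_le_1 P) n \<and>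
             speed (max_degree_le_1 P) n \<ge> matching_sum n)) \<and>
     (\<exists>\<epsilon> :: nat \<Rightarrow> real. \<epsilon> \<in> o(\<lambda>n. real n) \<and>
        (\<forall>n\<ge>1. real (matching_sum n) = real n powr (real n / 2 + \<epsilon> n))) \<and>
     (\<exists>Q. monotone_property Q \<and> superexponential Q \<and>
        (\<forall>n. speed Q n = matching_sum n)) \<and>
     (\<exists>!Q. monotone_property Q \<and> (\<forall>n. speed Q n = matching_sum n))"
proof (intro conjI allI impI)
  fix P :: "nat ograph set" assume "monotone_property P \<and> superexponential P"
  then have P: "monotone_property P" "superexponential P" by auto
  then have gp: "graph_property P" by (simp add: monotone_property_def)
  show "perm_graph k \<pi> \<in> P" if "\<pi> permutes {1..k}" for k \<pi>
  proof -
    have "split_graphs \<subseteq> P"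
      using graph_property_subset[OF _ gp] monotone_split_graphs split_matchings_subset_codes[OF P]
      by (simp add: monotone_property_def codes_split_graphs)
    then show ?thesis using perm_graph_in_split_graphs[OF that] by blast
  qed
  show "speed (max_degree_le_1 P) n \<le> speed P n" for n
    by (rule speed_mono) (use gp in \<open>auto simp: max_degree_le_1_def graph_property_def\<close>)
  show "matching_sum n \<le> speed (max_degree_le_1 P) n" for n
    by (rule matching_sum_le_speed_max_degree[OF P])
next
  show "\<exists>\<epsilon> :: nat \<Rightarrow> real. \<epsilon> \<in> o(\<lambda>n. real n) \<and>
    (\<forall>n\<ge>1. real (matching_sum n) = real n powr (real n / 2 + \<epsilon> n))"
    by (rule matching_sum_asymptotics)
next
  have "superexponential split_graphs"
    by (rule superexponential_if_speed_ge) (simp add: speed_split_graphs)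
  then show "\<exists>Q. monotone_property Q \<and> superexponential Q \<and> (\<forall>n. speed Q n = matching_sum n)"
    using monotone_split_graphs speed_split_graphs by blast
next
  show "\<exists>!Q. monotone_property Q \<and> (\<forall>n. speed Q n = matching_sum n)"
    by (rule ex1I[of _ split_graphs])
       (use monotone_split_graphs speed_split_graphs eq_split_graphs_if_speed_eq in auto)
qed

end
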